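(* For every $n$, there exists a triangle-free graph $G$ on $n$ vertices with independence number $$\alpha(G)\ \le\ (10+o(1))\sqrt{n\log n}.$$
   Context: Graphs are finite, simple and undirected; $\alpha(G)$ denotes the maximum size of an independent set in $G$. Here $\log$ is the natural logarithm and $o(1)$ denotes a quantity depending only on $n$ and tending to $0$ as $n\to\infty$.
   Formalization: The bound is stated for every n ≥ 2 rather than every n: at n = 1 the right-hand side is 0 while the independence number is 1, and at n = 0 the logarithm is undefined. *)

theory Defs
  imports
    "HOL-Analysis.Analysis"
    "Graph_Theory.Pair_Digraph"
begin

text \<open>
  A finite simple undirected graph is a \<^locale>\<open>pair_graph\<close>: a finite vertex set together with
  a symmetric and loop-free set of arcs (ordered pairs of vertices).
\<close>

text \<open>As the arcs of a \<^locale>\<open>pair_graph\<close> are symmetric and loop-free, three vertices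
  as below are automatically distinct and pairwise adjacent.\<close>

definition triangle_free :: "'a pair_pre_digraph \<Rightarrow> bool" where
  "triangle_free G \<longleftrightarrow>
     \<not> (\<exists>u v w. (u, v) \<in> parcs G \<and> (v, w) \<in> parcs G \<and> (w, u) \<in> parcs G)"

definition independent_set :: "'a pair_pre_digraph \<Rightarrow> 'a set \<Rightarrow> bool" where
  "independent_set G S \<longleftrightarrow> S \<subseteq> pverts G \<and> (\<forall>u\<in>S. \<forall>v\<in>S. (u, v) \<notin> parcs G)"

definition independence_number :: "'a pair_pre_digraph \<Rightarrow> nat" where
  "independence_number G = Max (card ` {S. independent_set G S})"

end

theory Submission
  imports Defs "HOL-Real_Asymp.Real_Asymp"
begin

text \<open>
  Two random maps \<open>f\<close>, \<open>f'\<close> group the \<open>n\<close> vertices into about \<open>n powr 0.95\<close> blocks each, and two random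
  graphs \<open>R\<close>, \<open>R'\<close> of edge density about \<open>sqrt (ln n / n)\<close> on the blocks are blown up along them.
  Two of the three edges of a triangle in the union come from the same blow-up, so it suffices to
  delete every edge whose end blocks have a common neighbour in the other block graph (and, inside one
  block graph, to break its own triangles). Since the blocks are large, a pair of blocks typically has
  no common neighbour, and only few edges are deleted.

  A set of \<open>k > 10 sqrt (n ln n)\<close> vertices may be squeezed into few blocks by one of the maps but not by
  both: one of them is injective on some subset \<open>T\<close> of \<open>a = 4 sqrt (n ln n)\<close> vertices.
  The pairs of \<open>T\<close> closed by the other block graph are, up to lower order terms, covered by cliques on
  almost disjoint blown-up neighbourhoods of size at most \<open>9/4 sqrt (n ln n)\<close>, so that a constant proportion of the pairs of
  \<open>T\<close> remains open. The probability that no open pair is an edge then beats the number of choices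
  of \<open>T\<close>.
\<close>

subsection \<open>Tail bounds for random functions\<close>

text \<open>In a plain random graph of density \<open>sqrt (ln n / n)\<close> on \<open>n\<close>
  vertices a pair has about \<open>ln n\<close> common neighbours, so almost every edge would be
  closed. On \<open>m\<close> blocks the expected number is \<open>m / q^2\<close>, about
  \<open>ln n / n powr 0.05\<close>. The price is that edges are independent only along sets on
  which a map is injective. Write \<open>A = sqrt (n ln n)\<close>, \<open>a = t * A\<close>,
  \<open>k = 10 * A\<close>; the following holds up to lower order terms. Fibres and degrees exceed
  their means by at most a factor 3/2 each, so the other graph closes at most a proportion
  \<open>9 / (4 t)\<close> of the pairs of \<open>T\<close>. The exponent gained is
  \<open>(t - 9/4) / 2 * a * ln n\<close>; it beats the \<open>a * ln n / 2\<close> for the choice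
  of \<open>T\<close> if \<open>t > 13/4\<close>. One map squeezes a fixed \<open>k\<close>-set into
  fewer than \<open>a\<close> blocks with probability about
  \<open>n powr (- 0.45 * (k - a))\<close>. The square of this beats the
  \<open>n powr (k / 2)\<close> choices of the set if \<open>a < 4/9 * k\<close>, that is
  \<open>t < 40/9\<close>. The value \<open>t = 4\<close> meets both demands. Probability is
  counting in finite function spaces: each position takes one of \<open>q\<close> values and the
  value 0 is an edge.\<close>

lemma finite_lessThan_PiE: "finite E \<Longrightarrow> finite (E \<rightarrow>\<^sub>E {..<q::nat})"
  by (intro finite_PiE) auto

lemma card_lessThan_PiE: "finite E \<Longrightarrow> card (E \<rightarrow>\<^sub>E {..<q::nat}) = q ^ card E"
  by (subst card_PiE) auto

text \<open>This is the moment generating function of a binomial variable, times the number of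
  functions. The weight is a product over coordinates, so the sum of products turns into a product
  of sums.\<close>

lemma sum_power_card_PiE:
  fixes \<kappa> :: real and q :: nat
  assumes "finite E" "P \<subseteq> E" "c < q"
  shows "(\<Sum>f\<in>E \<rightarrow>\<^sub>E {..<q}. \<kappa> ^ card {e\<in>P. f e = c})
       = real q ^ card E * (1 + (\<kappa> - 1) / q) ^ card P"
proof -
  have "finite P" using assms finite_subset by blast
  have *: "\<kappa> ^ card {e\<in>P. f e = c} = (\<Prod>e\<in>E. if e \<in> P \<and> f e = c then \<kappa> else 1)" for f
  proof -
    have "(\<Prod>e\<in>E. if e \<in> P \<and> f e = c then \<kappa> else 1) = (\<Prod>e\<in>{e\<in>E. e \<in> P \<and> f e = c}. \<kappa>)"
      using assms(1) by (simp add: prod.If_cases Int_def)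
    also have "{e\<in>E. e \<in> P \<and> f e = c} = {e\<in>P. f e = c}" using assms(2) by auto
    finally show ?thesis by simp
  qed
  have inner: "(\<Sum>v<q. if e \<in> P \<and> v = c then \<kappa> else 1) = (if e \<in> P then real q + (\<kappa> - 1) else real q)" for e
  proof (cases "e \<in> P")
    case True
    have "(\<Sum>v<q. if v = c then \<kappa> else 1) = (\<Sum>v<q. 1 + (if v = c then \<kappa> - 1 else 0))"
      by (intro sum.cong) auto
    also have "\<dots> = real q + (\<kappa> - 1)" using assms(3) by (simp add: sum.distrib)
    finally show ?thesis using True by simp
  qed auto
  have "(\<Sum>f\<in>E \<rightarrow>\<^sub>E {..<q}. \<kappa> ^ card {e\<in>P. f e = c})
      = (\<Prod>e\<in>E. \<Sum>v<q. if e \<in> P \<and> v = c then \<kappa> else 1)"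
    using assms(1) by (subst prod_sum_PiE) (auto simp: *)
  also have "\<dots> = (\<Prod>e\<in>E. if e \<in> P then real q + (\<kappa> - 1) else real q)"
    by (simp only: inner)
  also have "\<dots> = (real q + (\<kappa> - 1)) ^ card P * real q ^ card (E - P)"
  proof -
    have "E \<inter> {e. e \<in> P} = P" "E \<inter> - {e. e \<in> P} = E - P" using assms(2) by auto
    then show ?thesis using assms(1) by (simp add: prod.If_cases)
  qed
  also have "(real q + (\<kappa> - 1)) = real q * (1 + (\<kappa> - 1) / q)"
    using assms(3) by (simp add: field_simps)
  also have "(real q * (1 + (\<kappa> - 1) / q)) ^ card P * real q ^ card (E - P)
      = real q ^ (card P + card (E - P)) * (1 + (\<kappa> - 1) / q) ^ card P"
    by (simp add: power_mult_distrib power_add)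
  also have "card P + card (E - P) = card E"
    using assms \<open>finite P\<close> by (metis add.commute card_Diff_subset card_mono le_add_diff_inverse2)
  finally show ?thesis .
qed

text \<open>Markov's inequality for \<open>\<kappa> ^ X\<close>, with \<open>\<kappa>\<close> left
  free: the uses range from 3/2, for concentration, to \<open>q\<close>, for the event that all
  given pairs are edges.\<close>

lemma card_PiE_tail:
  fixes \<kappa> r :: real and q :: nat
  assumes "finite E" "P \<subseteq> E" "c < q" "\<kappa> \<ge> 1"
  shows "real (card {f\<in>E \<rightarrow>\<^sub>E {..<q}. r \<le> real (card {e\<in>P. f e = c})})
       \<le> real q ^ card E * exp ((\<kappa> - 1) * card P / q) * \<kappa> powr (- r)"
proof -
  let ?\<Omega> = "E \<rightarrow>\<^sub>E {..<q}" and ?X = "\<lambda>f. card {e\<in>P. f e = c}"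
  let ?B = "{f\<in>?\<Omega>. r \<le> real (?X f)}"
  have fin: "finite ?\<Omega>" using assms(1) by (rule finite_lessThan_PiE)
  have "real (card ?B) * \<kappa> powr r = (\<Sum>f\<in>?B. \<kappa> powr r)" by simp
  also have "\<dots> \<le> (\<Sum>f\<in>?B. \<kappa> ^ ?X f)"
  proof (rule sum_mono)
    fix f assume "f \<in> ?B"
    then have "\<kappa> powr r \<le> \<kappa> powr real (?X f)"
      using assms(4) by (intro powr_mono) auto
    then show "\<kappa> powr r \<le> \<kappa> ^ ?X f" using assms(4) by (simp add: powr_realpow)
  qed
  also have "\<dots> \<le> (\<Sum>f\<in>?\<Omega>. \<kappa> ^ ?X f)"
    using fin assms(4) by (intro sum_mono2) auto
  also have "\<dots> = real q ^ card E * (1 + (\<kappa> - 1) / q) ^ card P"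
    by (rule sum_power_card_PiE) (use assms in auto)
  also have "\<dots> \<le> real q ^ card E * exp ((\<kappa> - 1) / q) ^ card P"
    using assms by (intro mult_left_mono power_mono exp_ge_add_one_self) auto
  also have "exp ((\<kappa> - 1) / q) ^ card P = exp ((\<kappa> - 1) * card P / q)"
    by (simp add: exp_of_nat_mult[symmetric] field_simps)
  finally have "real (card ?B) \<le> real q ^ card E * exp ((\<kappa> - 1) * card P / q) / \<kappa> powr r"
    using assms(4) by (simp add: field_simps)
  then show ?thesis by (simp add: powr_minus field_simps)
qed

lemma sum_PiE_insert:
  assumes "x \<notin> S"
  shows "(\<Sum>f\<in>insert x S \<rightarrow>\<^sub>E A. F f) = (\<Sum>f\<in>S \<rightarrow>\<^sub>E A. \<Sum>v\<in>A. F (f(x := v)))"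
proof -
  have "(\<Sum>f\<in>insert x S \<rightarrow>\<^sub>E A. F f) = (\<Sum>(v, f)\<in>A \<times> (S \<rightarrow>\<^sub>E A). F (f(x := v)))"
    unfolding PiE_insert_eq
    by (subst sum.reindex[OF inj_combinator[OF assms, of "\<lambda>_. A"]]) (simp add: comp_def case_prod_beta)
  also have "\<dots> = (\<Sum>v\<in>A. \<Sum>f\<in>S \<rightarrow>\<^sub>E A. F (f(x := v)))" by (simp add: sum.cartesian_product)
  finally show ?thesis by (simp add: sum.swap[of _ A])
qed

text \<open>The bits are exposed by increasing rank. An open position has one forbidden value out of
  \<open>q\<close>, and the weight \<open>q / (q - 1)\<close> compensates exactly for this loss.\<close>

lemma sum_open_le:
  fixes q :: nat and rank :: "'e \<Rightarrow> nat" and opn :: "('e \<Rightarrow> nat) \<Rightarrow> 'e \<Rightarrow> bool"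
  assumes "finite E" "q > 1"
    and "\<And>f g e. e \<in> E \<Longrightarrow> (\<And>d. d \<in> E \<Longrightarrow> rank d < rank e \<Longrightarrow> f d = g d) \<Longrightarrow> opn f e = opn g e"
  shows "(\<Sum>f\<in>{f\<in>E \<rightarrow>\<^sub>E {..<q}. \<forall>e\<in>E. opn f e \<longrightarrow> f e \<noteq> 0}. (real q / (real q - 1)) ^ card {e\<in>E. opn f e})
       \<le> real q ^ card E"
  using assms
proof (induction E rule: finite_ranking_induct[where f = rank])
  case empty
  then show ?case by simp
next
  case (insert x S)
  show ?case
  \<comment> \<open>The ranking induction does not promise that the added element is new.\<close>
  proof (cases "x \<in> S")
    case True
    then have eq: "insert x S = S" by blast
    show ?thesis unfolding eq by (rule insert.IH) (fact insert.prems[unfolded eq])+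
  next
    case x: False
    let ?\<Omega> = "S \<rightarrow>\<^sub>E {..<q}" and ?t = "real q / (real q - 1)"
    let ?good = "\<lambda>E f. \<forall>e\<in>E. opn f e \<longrightarrow> f e \<noteq> 0"
    let ?F = "\<lambda>E f. if ?good E f then ?t ^ card {e\<in>E. opn f e} else 0"
    have q: "real q > 1" using insert.prems by simp
    have fin: "finite ?\<Omega>" using insert.hyps(1) by (rule finite_lessThan_PiE)
    have IH: "(\<Sum>f\<in>{f\<in>?\<Omega>. ?good S f}. ?t ^ card {e\<in>S. opn f e}) \<le> real q ^ card S"
    proof (rule insert.IH[OF insert.prems(1)])
      fix f g :: "'e \<Rightarrow> nat" and e assume e: "e \<in> S" "\<And>d. d \<in> S \<Longrightarrow> rank d < rank e \<Longrightarrow> f d = g d"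
      show "opn f e = opn g e"
      proof (rule insert.prems(2))
        show "e \<in> insert x S" using e(1) by simp
        fix d assume d: "d \<in> insert x S" "rank d < rank e"
        then have "d \<in> S" using insert.hyps(2)[OF e(1)] by auto
        then show "f d = g d" using e(2) d(2) by blast
      qed
    qed
    \<comment> \<open>The added \<open>x\<close> has maximal rank and openness depends only on
      strictly smaller ranks, so the value at \<open>x\<close> affects no openness, not even that of
      \<open>x\<close>.\<close>
    have upd: "opn (f(x := v)) e = opn f e" if "e \<in> insert x S" for f v e
      using that by (intro insert.prems(2)) (fastforce dest: insert.hyps(2))+
    have step: "(\<Sum>v<q. ?F (insert x S) (f(x := v))) = real q * ?F S f" if "f \<in> ?\<Omega>" for f
    proof (cases "?good S f")
      case False
      then obtain e where e: "e \<in> S" "opn f e" "f e = 0" by blast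
      have "\<not> ?good (insert x S) (f(x := v))" for v
      proof
        assume "?good (insert x S) (f(x := v))"
        then have "opn (f(x := v)) e \<longrightarrow> (f(x := v)) e \<noteq> 0" using e by blast
        then show False using e upd[of e f v] x by (auto split: if_splits)
      qed
      then show ?thesis using False by (simp only: if_False sum.neutral_const mult_zero_right)
    next
      case True
      have g: "?good (insert x S) (f(x := v)) \<longleftrightarrow> (opn f x \<longrightarrow> v \<noteq> 0)" for v
      proof -
        have "opn (f(x := v)) e \<longrightarrow> (f(x := v)) e \<noteq> 0" if "e \<in> S" for e
          using that True upd[of e f v] x by (auto split: if_splits)
        then show ?thesis using upd[of x f v] by auto
      qed
      have c: "{e\<in>insert x S. opn (f(x := v)) e} = (if opn f x then insert x {e\<in>S. opn f e} else {e\<in>S. opn f e})" for v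
        using upd[of _ f v] by auto
      show ?thesis
      proof (cases "opn f x")
        case o: True
        have card: "card (insert x {e\<in>S. opn f e}) = Suc (card {e\<in>S. opn f e})"
          using insert.hyps x by (subst card_insert_disjoint) auto
        have "(\<Sum>v<q. ?F (insert x S) (f(x := v))) = (\<Sum>v<q. if v \<noteq> 0 then ?t ^ Suc (card {e\<in>S. opn f e}) else 0)"
          unfolding g c if_P[OF o] card using o by (intro sum.cong) auto
        also have "\<dots> = (\<Sum>v\<in>{1..<q}. ?t ^ Suc (card {e\<in>S. opn f e}))"
          by (rule sum.mono_neutral_cong_right) auto
        also have "\<dots> = (real q - 1) * ?t ^ Suc (card {e\<in>S. opn f e})" using q by (simp add: of_nat_diff)
        also have "\<dots> = real q * ?t ^ card {e\<in>S. opn f e}" using q by simp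
        finally show ?thesis using True by auto
      next
        case False
        then show ?thesis unfolding g c using True by simp
      qed
    qed
    have "(\<Sum>f\<in>{f\<in>insert x S \<rightarrow>\<^sub>E {..<q}. ?good (insert x S) f}. ?t ^ card {e\<in>insert x S. opn f e})
        = (\<Sum>f\<in>insert x S \<rightarrow>\<^sub>E {..<q}. ?F (insert x S) f)"
      using insert.hyps by (intro sum.mono_neutral_cong_left) (auto intro!: finite_lessThan_PiE)
    also have "\<dots> = (\<Sum>f\<in>?\<Omega>. \<Sum>v<q. ?F (insert x S) (f(x := v)))"
      by (rule sum_PiE_insert[OF x])
    also have "\<dots> = (\<Sum>f\<in>?\<Omega>. real q * ?F S f)"
      by (rule sum.cong[OF refl step])
    also have "\<dots> = real q * (\<Sum>f\<in>{f\<in>?\<Omega>. ?good S f}. ?t ^ card {e\<in>S. opn f e})"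
      unfolding sum_distrib_left[symmetric] using fin
      by (intro arg_cong2[where f = "(*)"] refl sum.mono_neutral_cong_right) auto
    also have "\<dots> \<le> real q * real q ^ card S" using IH by (intro mult_left_mono) auto
    finally show ?thesis using insert.hyps x by simp
  qed
qed

text \<open>Markov's inequality for the weight of the previous lemma, since
  \<open>q / (q - 1)\<close> is at least \<open>exp (1 / q)\<close>. Which positions are open may
  depend on \<open>f\<close> itself, so no conditioning is required. Positions outside
  \<open>P\<close> are treated as never open.\<close>

lemma card_no_open_zero_le:
  fixes q :: nat and U :: real and rank :: "'e \<Rightarrow> nat" and opn :: "('e \<Rightarrow> nat) \<Rightarrow> 'e \<Rightarrow> bool"
  assumes "finite E" "q > 1" "P \<subseteq> E"
    and dep: "\<And>f g e. e \<in> P \<Longrightarrow> (\<And>d. d \<in> E \<Longrightarrow> rank d < rank e \<Longrightarrow> f d = g d) \<Longrightarrow> opn f e = opn g e"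
  shows "real (card {f\<in>E \<rightarrow>\<^sub>E {..<q}. (\<forall>e\<in>P. opn f e \<longrightarrow> f e \<noteq> 0) \<and> U \<le> real (card {e\<in>P. opn f e})})
       \<le> real q ^ card E * exp (- U / q)"
proof -
  let ?o = "\<lambda>f e. e \<in> P \<and> opn f e" and ?t = "real q / (real q - 1)"
  let ?G = "{f\<in>E \<rightarrow>\<^sub>E {..<q}. \<forall>e\<in>E. ?o f e \<longrightarrow> f e \<noteq> 0}"
  let ?B = "{f\<in>E \<rightarrow>\<^sub>E {..<q}. (\<forall>e\<in>P. opn f e \<longrightarrow> f e \<noteq> 0) \<and> U \<le> real (card {e\<in>P. opn f e})}"
  have P: "{e\<in>E. ?o f e} = {e\<in>P. opn f e}" for f using assms(3) by auto
  have t: "exp (1 / q) \<le> ?t"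
  proof -
    have "1 - 1 / q \<le> exp (- (1 / q))" using exp_ge_add_one_self[of "- (1 / real q)"] by simp
    then have "exp (1 / q) * (1 - 1 / q) \<le> exp (1 / q) * exp (- (1 / q))" by (intro mult_left_mono) auto
    then have "exp (1 / q) * (1 - 1 / q) \<le> 1" by (simp flip: exp_add)
    then show ?thesis using assms(2) by (simp add: field_simps)
  qed
  have "real (card ?B) * exp (U / q) = (\<Sum>f\<in>?B. exp (U / q))" by simp
  also have "\<dots> \<le> (\<Sum>f\<in>?B. ?t ^ card {e\<in>E. ?o f e})"
  proof (rule sum_mono)
    fix f assume f: "f \<in> ?B"
    have "exp (U / q) \<le> exp (card {e\<in>P. opn f e} * (1 / q))"
      using f by (simp add: divide_right_mono)
    also have "\<dots> = exp (1 / q) ^ card {e\<in>P. opn f e}" by (rule exp_of_nat_mult)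
    also have "\<dots> \<le> ?t ^ card {e\<in>P. opn f e}" using t by (intro power_mono) auto
    finally show "exp (U / q) \<le> ?t ^ card {e\<in>E. ?o f e}" unfolding P .
  qed
  also have "\<dots> \<le> (\<Sum>f\<in>?G. ?t ^ card {e\<in>E. ?o f e})"
  proof (rule sum_mono2)
    show "finite ?G" using finite_lessThan_PiE[OF assms(1)] by simp
    show "?B \<subseteq> ?G" by blast
    show "0 \<le> ?t ^ card {e\<in>E. ?o f e}" for f using assms(2) by simp
  qed
  also have "\<dots> \<le> real q ^ card E"
    by (rule sum_open_le[where rank = rank]) (use assms dep in blast)+
  finally show ?thesis by (simp add: exp_minus field_simps)
qed

subsection \<open>Random graphs\<close>

text \<open>Unordered pairs are stored with the smaller end first; this first component is later the
  rank by which edges are exposed.\<close>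

definition pairs :: "nat \<Rightarrow> (nat \<times> nat) set" where
  "pairs m = {(x, y). x < y \<and> y < m}"

definition adj :: "nat \<Rightarrow> (nat \<times> nat \<Rightarrow> nat) \<Rightarrow> nat \<Rightarrow> nat \<Rightarrow> bool" where
  "adj m g x y \<longleftrightarrow> x < m \<and> y < m \<and> x \<noteq> y \<and> g (min x y, max x y) = 0"

text \<open>Ordered incidences are counted, so an edge inside \<open>Z \<inter> B\<close> counts
  twice.\<close>

definition edge_count :: "(nat \<Rightarrow> nat \<Rightarrow> bool) \<Rightarrow> nat set \<Rightarrow> nat set \<Rightarrow> nat" where
  "edge_count R Z B = card {(z, y). z \<in> Z \<and> y \<in> B \<and> R z y}"

lemma adj_sym: "adj m g x y \<longleftrightarrow> adj m g y x"
  by (auto simp: adj_def min.commute max.commute)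

lemma adj_irrefl: "\<not> adj m g x x"
  by (simp add: adj_def)

lemma adj_less: "adj m g x y \<Longrightarrow> x < m \<and> y < m"
  by (simp add: adj_def)

lemma finite_pairs: "finite (pairs m)"
  by (rule finite_subset[of _ "{..<m} \<times> {..<m}"]) (auto simp: pairs_def)

lemma edge_count_eq_sum:
  assumes "finite Z" "finite B"
  shows "edge_count R Z B = (\<Sum>z\<in>Z. card {y\<in>B. R z y})"
proof -
  have "{(z, y). z \<in> Z \<and> y \<in> B \<and> R z y} = (SIGMA z:Z. {y\<in>B. R z y})" by auto
  then show ?thesis using assms unfolding edge_count_def by (simp add: card_SigmaI)
qed

text \<open>One random bit may be counted in both orders, which halves the exponent in the general
  bound; for disjoint sets this cannot happen. The disjoint form is kept separately because the
  bound on vertices with two neighbours in \<open>B\<close> has no room for the lost factor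
  2.\<close>

lemma card_edge_count_tail:
  fixes \<kappa> r :: real
  assumes sub: "Z \<subseteq> {..<m}" "B \<subseteq> {..<m}" and "0 < q" "1 \<le> \<kappa>"
  shows "real (card {g\<in>pairs m \<rightarrow>\<^sub>E {..<q}. r \<le> real (edge_count (adj m g) Z B)})
       \<le> real q ^ card (pairs m) * exp ((\<kappa> - 1) * (card Z * card B) / q) * \<kappa> powr (- (r / 2))" (is ?general)
    and "Z \<inter> B = {} \<Longrightarrow> real (card {g\<in>pairs m \<rightarrow>\<^sub>E {..<q}. r \<le> real (edge_count (adj m g) Z B)})
       \<le> real q ^ card (pairs m) * exp ((\<kappa> - 1) * (card Z * card B) / q) * \<kappa> powr (- r)" (is "_ \<Longrightarrow> ?disjoint")
proof -
  let ?h = "\<lambda>(z, y). (min z y, max z y :: nat)"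
  let ?D = "{(z, y). z \<in> Z \<and> y \<in> B \<and> z \<noteq> y}"
  let ?P = "?h ` ?D"
  let ?X = "\<lambda>g :: nat \<times> nat \<Rightarrow> nat. card {e\<in>?P. g e = 0}"
  let ?C = "\<lambda>g. {(z, y). z \<in> Z \<and> y \<in> B \<and> adj m g z y}"
  have fin: "finite Z" "finite B" using sub finite_subset by blast+
  have D: "?D \<subseteq> Z \<times> B" by auto
  then have finD: "finite ?D" using fin finite_subset by blast
  have cardP: "card ?P \<le> card Z * card B"
    using card_image_le[OF finD, of ?h] card_mono[OF _ D] fin by (simp add: card_cartesian_product)
  have P: "?P \<subseteq> pairs m" using sub by (fastforce simp: pairs_def min_def max_def)
  have img: "?h ` ?C g \<subseteq> {e\<in>?P. g e = 0}" for g by (auto simp: adj_def)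
  have finX: "finite {e\<in>?P. g e = 0}" for g :: "nat \<times> nat \<Rightarrow> nat" using finD by simp
  have card_le_X: "card C' \<le> ?X g" if "C' \<subseteq> ?C g" "inj_on ?h C'" for C' g
  proof -
    have "?h ` C' \<subseteq> {e\<in>?P. g e = 0}" using image_mono[OF that(1), of ?h] img[of g] by (rule order_trans)
    then show ?thesis unfolding card_image[OF that(2), symmetric] by (rule card_mono[OF finX])
  qed
  have half: "edge_count (adj m g) Z B \<le> 2 * ?X g" for g
  proof -
    let ?C1 = "{(z, y). (z, y) \<in> ?C g \<and> z < y}" and ?C2 = "{(z, y). (z, y) \<in> ?C g \<and> y < z}"
    have sub: "?C1 \<subseteq> ?C g" "?C2 \<subseteq> ?C g" by auto

    have inj: "inj_on ?h ?C1" "inj_on ?h ?C2" by (auto simp: inj_on_def)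
    have "card ?C1 \<le> ?X g" "card ?C2 \<le> ?X g"
      using card_le_X[OF sub(1) inj(1)] card_le_X[OF sub(2) inj(2)] by blast+
    moreover have "?C g = ?C1 \<union> ?C2" by (auto simp: adj_def)
    then have "card (?C g) \<le> card ?C1 + card ?C2" using card_Un_le[of ?C1 ?C2] by (simp only:)
    ultimately show ?thesis unfolding edge_count_def by linarith
  qed
  have mgf: "real (card {g\<in>pairs m \<rightarrow>\<^sub>E {..<q}. s \<le> real (?X g)})
       \<le> real q ^ card (pairs m) * exp ((\<kappa> - 1) * (card Z * card B) / q) * \<kappa> powr (- s)" for s
  proof -
    have "real (card {g\<in>pairs m \<rightarrow>\<^sub>E {..<q}. s \<le> real (?X g)})
       \<le> real q ^ card (pairs m) * exp ((\<kappa> - 1) * card ?P / q) * \<kappa> powr (- s)"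
      by (rule card_PiE_tail) (use finite_pairs P assms in auto)
    also have "\<dots> \<le> real q ^ card (pairs m) * exp ((\<kappa> - 1) * (card Z * card B) / q) * \<kappa> powr (- s)"
    proof -
      have "real (card ?P) \<le> real (card Z * card B)" using cardP by (rule of_nat_mono)
      then show ?thesis using assms(3,4)
        by (intro mult_right_mono mult_left_mono iffD2[OF exp_le_cancel_iff] divide_right_mono) auto
    qed
    finally show ?thesis .
  qed
  have fin\<Omega>: "finite (pairs m \<rightarrow>\<^sub>E {..<q})" using finite_lessThan_PiE finite_pairs by blast
  have le: "real (card {g\<in>pairs m \<rightarrow>\<^sub>E {..<q}. r \<le> real (edge_count (adj m g) Z B)})
      \<le> real (card {g\<in>pairs m \<rightarrow>\<^sub>E {..<q}. s \<le> real (?X g)})"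
    if "\<And>g. r \<le> real (edge_count (adj m g) Z B) \<Longrightarrow> s \<le> real (?X g)" for s
    using that fin\<Omega> by (intro of_nat_mono card_mono) auto
  show ?general
  proof (rule order_trans[OF le mgf])
    fix g assume "r \<le> real (edge_count (adj m g) Z B)"
    also have "\<dots> \<le> real (2 * ?X g)" using half[of g] by (rule of_nat_mono)
    finally show "r / 2 \<le> real (?X g)" by simp
  qed
  show ?disjoint if "Z \<inter> B = {}"
  proof (rule order_trans[OF le mgf])
    fix g assume r: "r \<le> real (edge_count (adj m g) Z B)"
    have "inj_on ?h (?C g)" using that by (auto simp: inj_on_def min_def max_def split: if_splits)
    then have "edge_count (adj m g) Z B \<le> ?X g"
      unfolding edge_count_def by (intro card_le_X) auto
    then show "r \<le> real (?X g)" using r by linarith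
  qed
qed

lemma sum_Pow_power_card:
  fixes t :: real
  assumes "finite A"
  shows "(\<Sum>X\<in>Pow A. t ^ card X) = (1 + t) ^ card A"
  using prod_add[OF assms, of "\<lambda>_. t" "\<lambda>_. 1"] by (simp add: add.commute)

text \<open>If each set \<open>X\<close> is given the weight \<open>m\<close> to the power
  \<open>- card X\<close>, a union bound over all subsets of every size at once costs only a factor
  \<open>exp 1\<close>.\<close>

lemma sum_Pow_inverse_power_le:
  "(\<Sum>X\<in>Pow {..<m::nat}. (1 / real m) ^ card X) \<le> exp 1"
proof -
  have "(1 + 1 / real m) ^ m \<le> exp (1 / real m) ^ m"
    by (intro power_mono exp_ge_add_one_self) auto
  also have "\<dots> \<le> exp 1" by (simp flip: exp_of_nat_mult)
  finally show ?thesis by (simp add: sum_Pow_power_card)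
qed

text \<open>A single term of the expansion of \<open>(1 + k / n) ^ n\<close> is at most the whole,
  which is at most \<open>exp k\<close>.\<close>

lemma binomial_le_exp_power:
  assumes "0 < k" "k \<le> n"
  shows "real (n choose k) \<le> (exp 1 * real n / real k) ^ k"
proof -
  let ?t = "real k / real n"
  have "real (n choose k) * ?t ^ k \<le> (\<Sum>i\<le>n. real (n choose i) * ?t ^ i)"
    by (rule member_le_sum) (use assms in auto)
  also have "\<dots> = (1 + ?t) ^ n"
    using binomial_ring[of ?t 1 n] by (simp add: add.commute)
  also have "\<dots> \<le> exp ?t ^ n"
    by (intro power_mono exp_ge_add_one_self) auto
  also have "\<dots> = exp 1 ^ k"
    using assms by (simp flip: exp_of_nat_mult)
  finally have "real (n choose k) \<le> exp 1 ^ k / ?t ^ k"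
    using assms by (simp add: pos_le_divide_eq)
  then show ?thesis by (simp add: power_divide power_mult_distrib)
qed

lemma card_Bex_le:
  assumes "finite I" "\<And>i. i \<in> I \<Longrightarrow> real (card {g\<in>\<Omega>. Q i g}) \<le> b i"
  shows "real (card {g\<in>\<Omega>. \<exists>i\<in>I. Q i g}) \<le> (\<Sum>i\<in>I. b i)"
proof -
  have eq: "{g\<in>\<Omega>. \<exists>i\<in>I. Q i g} = (\<Union>i\<in>I. {g\<in>\<Omega>. Q i g})" by blast
  have "real (card {g\<in>\<Omega>. \<exists>i\<in>I. Q i g}) \<le> real (\<Sum>i\<in>I. card {g\<in>\<Omega>. Q i g})"
    unfolding eq by (rule of_nat_mono[OF card_UN_le[OF assms(1)]])
  also have "\<dots> = (\<Sum>i\<in>I. real (card {g\<in>\<Omega>. Q i g}))" by simp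
  also have "\<dots> \<le> (\<Sum>i\<in>I. b i)" by (rule sum_mono[OF assms(2)])
  finally show ?thesis .
qed

section \<open>Quasirandom properties of a block graph and the probability that they fail\<close>

definition max_degree_le :: "nat \<Rightarrow> real \<Rightarrow> (nat \<Rightarrow> nat \<Rightarrow> bool) \<Rightarrow> bool" where
  "max_degree_le m \<Delta> R \<longleftrightarrow> (\<forall>z<m. real (card {y\<in>{..<m}. R z y}) \<le> \<Delta>)"

definition codegree_le :: "nat \<Rightarrow> nat \<Rightarrow> (nat \<Rightarrow> nat \<Rightarrow> bool) \<Rightarrow> bool" where
  "codegree_le m D R \<longleftrightarrow> (\<forall>z<m. \<forall>z'<m. z \<noteq> z' \<longrightarrow> card {y\<in>{..<m}. R z y \<and> R z' y} \<le> D)"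

text \<open>The edges that rich vertices send to \<open>B\<close> are bounded in total, rather than
  the number of rich vertices: this sum, times the fibre size, bounds the total size of the blown-up
  neighbourhoods inside \<open>T\<close>.\<close>

definition rich_sum_le :: "nat \<Rightarrow> nat \<Rightarrow> real \<Rightarrow> real \<Rightarrow> (nat \<Rightarrow> nat \<Rightarrow> bool) \<Rightarrow> bool" where
  "rich_sum_le m a x K R \<longleftrightarrow> (\<forall>B\<subseteq>{..<m}. card B \<le> a \<longrightarrow>
     real (\<Sum>z\<in>{z\<in>{..<m}. x \<le> real (card {y\<in>B. R z y})}. card {y\<in>B. R z y}) \<le> K * a)"

text \<open>The vertices of \<open>B\<close> are left out so that the disjoint tail bound applies;
  adding them back later costs at most \<open>b\<close>.\<close>

definition pair_rich_le :: "nat \<Rightarrow> real \<Rightarrow> nat \<Rightarrow> (nat \<Rightarrow> nat \<Rightarrow> bool) \<Rightarrow> bool" where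
  "pair_rich_le m b N R \<longleftrightarrow> (\<forall>B\<subseteq>{..<m}. real (card B) \<le> b \<longrightarrow>
     card {z\<in>{..<m} - B. 2 \<le> card {y\<in>B. R z y}} \<le> N)"

text \<open>From \<open>9/25 \<le> ln (3/2)\<close> the exponent per unit of \<open>t\<close> is at
  most \<open>1/2 - 3/2 * 9/25 = - 1/25\<close>.\<close>

lemma chernoff_three_halves:
  assumes "0 \<le> t"
  shows "exp (1/2 * t) * (3/2 :: real) powr (- (3/2 * t)) \<le> exp (- (t / 25))"
proof -
  have "exp (9/25 :: real) \<le> 1 + 9/25 + (9/25)^2" by (rule exp_bound) auto
  also have "\<dots> \<le> 3/2" by (simp add: power2_eq_square)
  finally have "9/25 \<le> ln (3/2 :: real)" by (subst ln_ge_iff) auto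
  then have "(3/2 * t) * (9/25) \<le> (3/2 * t) * ln (3/2)"
    using assms by (intro mult_left_mono) auto
  then have "1/2 * t - 3/2 * t * ln (3/2) \<le> - (t / 25)" by simp
  then show ?thesis by (simp add: powr_def flip: exp_add)
qed

lemma card_not_max_degree_le:
  assumes "0 < q" "0 < m"
  shows "real (card {g\<in>pairs m \<rightarrow>\<^sub>E {..<q}. \<not> max_degree_le m (3/2 * m / q) (adj m g)})
    \<le> real m * (real q ^ card (pairs m) * exp (- (real m / (25 * real q))))"
proof -
  let ?\<Omega> = "pairs m \<rightarrow>\<^sub>E {..<q}"
  let ?Q = "\<lambda>z g. 3/2 * m / q \<le> real (edge_count (adj m g) {z} ({..<m} - {z}))"
  have fin: "finite ?\<Omega>" using finite_lessThan_PiE finite_pairs by blast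
  have *: "real (card {g\<in>?\<Omega>. ?Q z g}) \<le> real q ^ card (pairs m) * exp (- (real m / (25 * real q)))"
    if "z \<in> {..<m}" for z
  proof -
    have "real (card {g\<in>?\<Omega>. ?Q z g}) \<le> real q ^ card (pairs m) *
        exp ((3/2 - 1) * (card {z} * card ({..<m} - {z})) / q) * (3/2) powr (- (3/2 * m / q))"
      by (rule card_edge_count_tail(2)) (use that assms in auto)
    also have "\<dots> \<le> real q ^ card (pairs m) * exp ((1/2) * (m / q)) * (3/2) powr (- (3/2 * (m / q)))"
      using that by (intro mult_mono mult_left_mono) (auto simp: divide_right_mono card_Diff_singleton)
    also have "\<dots> \<le> real q ^ card (pairs m) * exp (- (real m / (25 * real q)))"
      using mult_left_mono[OF chernoff_three_halves[of "real m / real q"], of "real q ^ card (pairs m)"]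
      by (simp add: mult.assoc mult.commute[of 25])
    finally show ?thesis .
  qed
  have "{g\<in>?\<Omega>. \<not> max_degree_le m (3/2 * m / q) (adj m g)} \<subseteq> {g\<in>?\<Omega>. \<exists>z\<in>{..<m}. ?Q z g}"
  proof (intro subsetI CollectI conjI)
    fix g assume g: "g \<in> {g\<in>?\<Omega>. \<not> max_degree_le m (3/2 * m / q) (adj m g)}"
    then show "g \<in> ?\<Omega>" by blast
    from g obtain z where z: "z < m" "3/2 * m / q < real (card {y\<in>{..<m}. adj m g z y})"
      by (auto simp: max_degree_le_def not_le)
    have "{y\<in>{..<m}. adj m g z y} = {y \<in> {..<m} - {z}. adj m g z y}" by (auto simp: adj_def)
    then have "?Q z g" using z(2) by (simp add: edge_count_eq_sum)
    then show "\<exists>z\<in>{..<m}. ?Q z g" using z(1) by blast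
  qed
  then have "real (card {g\<in>?\<Omega>. \<not> max_degree_le m (3/2 * m / q) (adj m g)}) \<le> real (card {g\<in>?\<Omega>. \<exists>z\<in>{..<m}. ?Q z g})"
    using fin by (intro of_nat_mono card_mono) auto
  also have "\<dots> \<le> (\<Sum>z\<in>{..<m}. real q ^ card (pairs m) * exp (- (real m / (25 * real q))))"
    by (rule card_Bex_le[OF _ *]) auto
  finally show ?thesis by simp
qed

text \<open>Two vertices and \<open>D + 1\<close> common neighbours can be chosen in at most
  \<open>m ^ (D + 3)\<close> ways, and then \<open>2 * (D + 1)\<close> prescribed pairs are all
  edges. The tail bound is taken at \<open>\<kappa> = q\<close>, where it gives at most
  \<open>exp 1 / q\<close> per pair.\<close>

lemma card_not_codegree_le:
  assumes "0 < q" "0 < m"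
  shows "real (card {g\<in>pairs m \<rightarrow>\<^sub>E {..<q}. \<not> codegree_le m D (adj m g)})
    \<le> real m ^ (D + 3) * (real q ^ card (pairs m) * (exp 1 / real q) ^ (2 * (D + 1)))"
proof -
  let ?\<Omega> = "pairs m \<rightarrow>\<^sub>E {..<q}"
  let ?I = "{..<m} \<times> {..<m} \<times> {Y. Y \<subseteq> {..<m} \<and> card Y = D + 1}"
  let ?Q = "\<lambda>(z, z', Y) g. z \<noteq> z' \<and> {z, z'} \<inter> Y = {} \<and> real (2 * (D + 1)) \<le> real (edge_count (adj m g) {z, z'} Y)"
  have fin: "finite ?\<Omega>" using finite_lessThan_PiE finite_pairs by blast
  have finI: "finite ?I" by auto
  have *: "real (card {g\<in>?\<Omega>. ?Q i g}) \<le> real q ^ card (pairs m) * (exp 1 / real q) ^ (2 * (D + 1))"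
    if i: "i \<in> ?I" for i
  proof -
    obtain z z' Y where eq: "i = (z, z', Y)" by (cases i)
    show ?thesis
    proof (cases "z \<noteq> z' \<and> {z, z'} \<inter> Y = {}")
      case False
      then have "{g\<in>?\<Omega>. ?Q i g} = {}" by (auto simp: eq)
      then show ?thesis using assms by (simp only: card.empty) simp
    next
      case True
      have "real (card {g\<in>?\<Omega>. ?Q i g}) = real (card {g\<in>?\<Omega>. real (2 * (D + 1)) \<le> real (edge_count (adj m g) {z, z'} Y)})"
        using True by (simp add: eq)
      also have "\<dots> \<le> real q ^ card (pairs m) *
          exp ((real q - 1) * (card {z, z'} * card Y) / q) * real q powr (- real (2 * (D + 1)))"
        by (rule card_edge_count_tail(2)) (use i True assms in \<open>auto simp: eq\<close>)
      also have "card {z, z'} * card Y = 2 * (D + 1)" using True i by (simp add: eq)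
      also have "exp ((real q - 1) * real (2 * (D + 1)) / q) \<le> exp (real (2 * (D + 1)))"
        using assms by (simp add: field_simps)
      also have "exp (real (2 * (D + 1))) = exp 1 ^ (2 * (D + 1))"
        using exp_of_nat_mult[of "2 * (D + 1)" "1::real"] by simp
      also have "real q powr (- real (2 * (D + 1))) = 1 / real q ^ (2 * (D + 1))"
        using assms by (simp only: powr_minus_divide powr_realpow of_nat_0_less_iff)
      finally show ?thesis using assms by (simp add: power_divide)
    qed
  qed
  have "{g\<in>?\<Omega>. \<not> codegree_le m D (adj m g)} \<subseteq> {g\<in>?\<Omega>. \<exists>i\<in>?I. ?Q i g}"
  proof (intro subsetI CollectI conjI)
    fix g assume g: "g \<in> {g\<in>?\<Omega>. \<not> codegree_le m D (adj m g)}"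
    then show "g \<in> ?\<Omega>" by blast
    from g obtain z z' where z: "z < m" "z' < m" "z \<noteq> z'" "D + 1 \<le> card {y\<in>{..<m}. adj m g z y \<and> adj m g z' y}"
      by (auto simp: codegree_le_def not_le)
    then obtain Y where Y: "Y \<subseteq> {y\<in>{..<m}. adj m g z y \<and> adj m g z' y}" "card Y = D + 1"
      by (meson obtain_subset_with_card_n)
    have finY: "finite Y" using Y(2) card.infinite by fastforce
    have "{y\<in>Y. adj m g z y} = Y" "{y\<in>Y. adj m g z' y} = Y" using Y(1) by auto
    then have "edge_count (adj m g) {z, z'} Y = 2 * (D + 1)"
      using z(3) Y(2) finY by (simp add: edge_count_eq_sum)
    moreover have "{z, z'} \<inter> Y = {}" using Y(1) by (auto simp: adj_def)
    ultimately have "(z, z', Y) \<in> ?I" "?Q (z, z', Y) g" using z Y by auto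
    then show "\<exists>i\<in>?I. ?Q i g" by blast
  qed
  then have "real (card {g\<in>?\<Omega>. \<not> codegree_le m D (adj m g)}) \<le> real (card {g\<in>?\<Omega>. \<exists>i\<in>?I. ?Q i g})"
    using fin by (intro of_nat_mono card_mono) auto
  also have "\<dots> \<le> (\<Sum>i\<in>?I. real q ^ card (pairs m) * (exp 1 / real q) ^ (2 * (D + 1)))"
    by (rule card_Bex_le[OF finI *])
  also have "\<dots> = real (card ?I) * (real q ^ card (pairs m) * (exp 1 / real q) ^ (2 * (D + 1)))" by simp
  also have "\<dots> \<le> real m ^ (D + 3) * (real q ^ card (pairs m) * (exp 1 / real q) ^ (2 * (D + 1)))"
  proof (rule mult_right_mono)
    have "m choose (D + 1) \<le> m ^ (D + 1)"
      by (cases "D + 1 \<le> m") (auto intro: binomial_le_pow simp del: power_Suc simp: binomial_eq_0)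
    then have "m * (m * (m choose (D + 1))) \<le> m * (m * m ^ (D + 1))" by (intro mult_left_mono) auto
    moreover have "card ?I = m * (m * (m choose (D + 1)))"
      using n_subsets[of "{..<m}" "D + 1"] by (simp only: card_cartesian_product card_lessThan finite_lessThan)
    ultimately have "card ?I \<le> m * (m * m ^ (D + 1))" by (simp only:)
    also have "\<dots> = m ^ (D + 3)" by (simp add: numeral_3_eq_3)
    finally show "real (card ?I) \<le> real m ^ (D + 3)" unfolding of_nat_power[symmetric] by (rule of_nat_mono)
  qed auto
  finally show ?thesis .
qed

text \<open>If the bound fails for \<open>B\<close> with rich set \<open>Z\<close>, the edge count
  is at least \<open>x * card Z\<close> and at least \<open>K * a\<close>, hence at least their
  mean. \<open>Z\<close> and \<open>B\<close> may overlap, so the gain in the exponent is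
  \<open>(x * card Z + K * a) / 4 * ln \<kappa>\<close>. Half of its first part pays for the mean
  term (\<open>h1\<close>) and half for the choice of \<open>Z\<close> (\<open>h2\<close>); the
  second part pays for the choice of \<open>B\<close> and leaves \<open>exp (- a)\<close>
  (\<open>h3\<close>).\<close>

lemma card_not_rich_sum_le:
  fixes \<kappa> x K :: real
  assumes "0 < q" "0 < m" "1 \<le> \<kappa>"
    and h1: "8 * \<kappa> * a / q \<le> x * ln \<kappa>" and h2: "8 * ln m \<le> x * ln \<kappa>"
    and h3: "4 * (ln m + 1) \<le> K * ln \<kappa>"
  shows "real (card {g\<in>pairs m \<rightarrow>\<^sub>E {..<q}. \<not> rich_sum_le m a x K (adj m g)})
    \<le> real q ^ card (pairs m) * exp (2 - real a)"
proof -
  let ?\<Omega> = "pairs m \<rightarrow>\<^sub>E {..<q}"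
  let ?I = "Pow {..<m} \<times> {B\<in>Pow {..<m}. card B \<le> a}"
  let ?Q = "\<lambda>(Z, B) g. (x * card Z + K * a) / 2 \<le> real (edge_count (adj m g) Z B)"
  let ?t = "\<lambda>X :: nat set. (1 / real m) ^ card X"
  have fin: "finite ?\<Omega>" using finite_lessThan_PiE finite_pairs by blast
  have finI: "finite ?I" by auto
  have t: "?t X = exp (- (ln m * card X))" for X
  proof -
    have "exp (- (ln m * card X)) = exp (- ln m) ^ card X"
      using exp_of_nat_mult[of "card X" "- ln (real m)"] by (simp add: mult.commute)
    then show ?thesis using assms(2) by (simp add: exp_minus inverse_eq_divide)
  qed
  have *: "real (card {g\<in>?\<Omega>. ?Q i g}) \<le> real q ^ card (pairs m) * exp (- real a) * (?t (fst i) * ?t (snd i))"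
    if i: "i \<in> ?I" for i
  proof -
    obtain Z B where eq: "i = (Z, B)" by (cases i)
    have "real (card {g\<in>?\<Omega>. ?Q i g}) \<le> real q ^ card (pairs m) *
        exp ((\<kappa> - 1) * (card Z * card B) / q) * \<kappa> powr (- ((x * card Z + K * a) / 2 / 2))"
      unfolding eq prod.case by (rule card_edge_count_tail(1)) (use i assms in \<open>auto simp: eq\<close>)
    also have "\<dots> = real q ^ card (pairs m) *
        exp ((\<kappa> - 1) * (card Z * card B) / q - (x * card Z + K * a) / 4 * ln \<kappa>)"
    proof -
      have pw: "\<kappa> powr (- ((x * card Z + K * a) / 2 / 2)) = exp (- ((x * card Z + K * a) / 4 * ln \<kappa>))"
        using assms(3) by (simp add: powr_def)
      show ?thesis unfolding pw by (simp only: diff_conv_add_uminus exp_add mult.assoc)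
    qed
    also have "\<dots> \<le> real q ^ card (pairs m) * exp (- real a + (- (ln m * card Z) + - (ln m * card B)))"
    proof (intro mult_left_mono iffD2[OF exp_le_cancel_iff])
      have "(\<kappa> - 1) * (card Z * card B) / q \<le> \<kappa> * real (card Z * a) / q"
      proof (intro divide_right_mono mult_mono)
        show "real (card Z * card B) \<le> real (card Z * a)"
          using i by (intro of_nat_mono mult_left_mono) (auto simp: eq)
      qed (use assms(1,3) in auto)
      also have "\<dots> = card Z * (8 * \<kappa> * a / q) / 8" by simp
      also have "\<dots> \<le> card Z * (x * ln \<kappa>) / 8"
        using h1 by (intro divide_right_mono mult_left_mono) auto
      finally have 1: "(\<kappa> - 1) * (card Z * card B) / q \<le> card Z * (x * ln \<kappa>) / 8" .
      have 2: "8 * (ln m * card Z) \<le> card Z * (x * ln \<kappa>)"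
        using mult_left_mono[OF h2, of "real (card Z)"] by (simp add: mult_ac)
      have 3: "4 * (ln m * a) + 4 * a \<le> a * (K * ln \<kappa>)"
        using mult_left_mono[OF h3, of "real a"] by (simp add: algebra_simps)
      have 4: "ln m * card B \<le> ln m * a"
        using i assms(2) by (intro mult_left_mono) (auto simp: eq)
      have 5: "(x * card Z + K * a) / 4 * ln \<kappa> = card Z * (x * ln \<kappa>) / 4 + a * (K * ln \<kappa>) / 4"
        by (simp add: field_simps)
      show "(\<kappa> - 1) * (card Z * card B) / q - (x * card Z + K * a) / 4 * ln \<kappa>
          \<le> - real a + (- (ln m * card Z) + - (ln m * card B))"
        unfolding 5 using 1 2 3 4 by linarith
    qed auto
    also have "\<dots> = real q ^ card (pairs m) * exp (- real a) * (?t (fst i) * ?t (snd i))"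
      unfolding t eq by (simp only: exp_add fst_conv snd_conv mult.assoc)
    finally show ?thesis .
  qed
  have "{g\<in>?\<Omega>. \<not> rich_sum_le m a x K (adj m g)} \<subseteq> {g\<in>?\<Omega>. \<exists>i\<in>?I. ?Q i g}"
  proof (intro subsetI CollectI conjI)
    fix g assume g: "g \<in> {g\<in>?\<Omega>. \<not> rich_sum_le m a x K (adj m g)}"
    then show "g \<in> ?\<Omega>" by blast
    from g obtain B where B: "B \<subseteq> {..<m}" "card B \<le> a"
      "K * a < real (\<Sum>z\<in>{z\<in>{..<m}. x \<le> real (card {y\<in>B. adj m g z y})}. card {y\<in>B. adj m g z y})"
      by (auto simp: rich_sum_le_def not_le)
    let ?Z = "{z\<in>{..<m}. x \<le> real (card {y\<in>B. adj m g z y})}"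
    have "finite B" using B(1) finite_subset by blast
    then have e: "edge_count (adj m g) ?Z B = (\<Sum>z\<in>?Z. card {y\<in>B. adj m g z y})"
      by (simp add: edge_count_eq_sum)
    have "x * card ?Z = (\<Sum>z\<in>?Z. x)" by simp
    also have "\<dots> \<le> (\<Sum>z\<in>?Z. real (card {y\<in>B. adj m g z y}))" by (rule sum_mono) auto
    finally have "?Q (?Z, B) g" using B(3) e by simp
    moreover have "(?Z, B) \<in> ?I" using B by auto
    ultimately show "\<exists>i\<in>?I. ?Q i g" by blast
  qed
  then have "real (card {g\<in>?\<Omega>. \<not> rich_sum_le m a x K (adj m g)}) \<le> real (card {g\<in>?\<Omega>. \<exists>i\<in>?I. ?Q i g})"
    using fin by (intro of_nat_mono card_mono) auto
  also have "\<dots> \<le> (\<Sum>i\<in>?I. real q ^ card (pairs m) * exp (- real a) * (?t (fst i) * ?t (snd i)))"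
    by (rule card_Bex_le[OF finI *])
  also have "\<dots> \<le> (\<Sum>i\<in>Pow {..<m} \<times> Pow {..<m}. real q ^ card (pairs m) * exp (- real a) * (?t (fst i) * ?t (snd i)))"
    by (rule sum_mono2) auto
  also have "\<dots> = real q ^ card (pairs m) * exp (- real a) * ((\<Sum>Z\<in>Pow {..<m}. ?t Z) * (\<Sum>B\<in>Pow {..<m}. ?t B))"
    unfolding sum_distrib_left[symmetric] by (simp add: sum_product sum.cartesian_product case_prod_beta)
  also have "\<dots> \<le> real q ^ card (pairs m) * exp (- real a) * (exp 1 * exp 1)"
    by (intro mult_left_mono mult_mono sum_Pow_inverse_power_le) (auto intro!: sum_nonneg)
  also have "\<dots> = real q ^ card (pairs m) * exp (2 - real a)"
    by (simp add: exp_diff exp_minus field_simps flip: exp_add)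
  finally show ?thesis .
qed

text \<open>Failure gives \<open>N\<close> vertices outside \<open>B\<close> with
  \<open>2 * N\<close> edges to \<open>B\<close>. By \<open>h1\<close> the mean term costs at most
  \<open>exp N\<close>; by \<open>h2\<close> there are at most \<open>exp (1 + N)\<close> choices of
  \<open>B\<close>; by \<open>h3\<close> the choice of the \<open>N\<close> vertices and the factor
  \<open>(exp 1 / \<kappa>^2) ^ N\<close> together leave \<open>exp (- 2 * N)\<close>.\<close>

lemma card_not_pair_rich_le:
  fixes \<kappa> b :: real
  assumes "0 < q" "0 < m" "1 \<le> \<kappa>" "0 < N"
    and h1: "\<kappa> * b \<le> q" and h2: "b * ln m \<le> N" and h3: "m * exp 4 \<le> N * \<kappa>\<^sup>2"
  shows "real (card {g\<in>pairs m \<rightarrow>\<^sub>E {..<q}. \<not> pair_rich_le m b N (adj m g)})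
    \<le> real q ^ card (pairs m) * exp (1 - real N)"
proof -
  let ?\<Omega> = "pairs m \<rightarrow>\<^sub>E {..<q}"
  let ?J = "{B\<in>Pow {..<m}. real (card B) \<le> b}" and ?J' = "{Z\<in>Pow {..<m}. card Z = N}"
  let ?Q = "\<lambda>(B, Z) g. Z \<inter> B = {} \<and> 2 * real N \<le> real (edge_count (adj m g) Z B)"
  let ?t = "\<lambda>X :: nat set. (1 / real m) ^ card X"
  have fin: "finite ?\<Omega>" using finite_lessThan_PiE finite_pairs by blast
  have finI: "finite (?J \<times> ?J')" by auto
  have *: "real (card {g\<in>?\<Omega>. ?Q i g}) \<le> real q ^ card (pairs m) * (exp 1 / \<kappa>\<^sup>2) ^ N"
    if i: "i \<in> ?J \<times> ?J'" for i
  proof -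
    obtain Z B where eq: "i = (B, Z)" by (cases i)
    show ?thesis
    proof (cases "Z \<inter> B = {}")
      case False
      then have "{g\<in>?\<Omega>. ?Q i g} = {}" by (auto simp: eq)
      then show ?thesis by (simp only: card.empty) simp
    next
      case True
      then have "real (card {g\<in>?\<Omega>. ?Q i g}) = real (card {g\<in>?\<Omega>. 2 * real N \<le> real (edge_count (adj m g) Z B)})"
        by (simp add: eq)
      also have "\<dots> \<le> real q ^ card (pairs m) *
          exp ((\<kappa> - 1) * (card Z * card B) / q) * \<kappa> powr (- (2 * real N))"
        by (rule card_edge_count_tail(2)) (use i True assms in \<open>auto simp: eq\<close>)
      also have "\<dots> \<le> real q ^ card (pairs m) * exp (real N) * \<kappa> powr (- (2 * real N))"
      proof (intro mult_right_mono mult_left_mono iffD2[OF exp_le_cancel_iff])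
        have "(\<kappa> - 1) * (card Z * card B) / q \<le> N * (\<kappa> * b) / q"
        proof (rule divide_right_mono)
          have "(\<kappa> - 1) * card B \<le> \<kappa> * b" using i assms(3) by (intro mult_mono) (auto simp: eq)
          then have "N * ((\<kappa> - 1) * card B) \<le> N * (\<kappa> * b)" by (intro mult_left_mono) auto
          then show "(\<kappa> - 1) * (card Z * card B) \<le> N * (\<kappa> * b)" using i by (simp add: eq algebra_simps)
        qed auto
        also have "\<dots> \<le> N * real q / q" using h1 by (intro divide_right_mono mult_left_mono) auto
        finally show "(\<kappa> - 1) * (card Z * card B) / q \<le> real N" using assms(1) by simp
      qed auto
      also have "\<kappa> powr (- (2 * real N)) = (1 / \<kappa>\<^sup>2) ^ N"
        using assms(3) powr_realpow[of \<kappa> "2 * N"] by (simp add: powr_minus_divide power_divide power_mult)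
      also have "exp (real N) = exp 1 ^ N" using exp_of_nat_mult[of N "1::real"] by simp
      also have "real q ^ card (pairs m) * exp 1 ^ N * (1 / \<kappa>\<^sup>2) ^ N
          = real q ^ card (pairs m) * (exp 1 / \<kappa>\<^sup>2) ^ N"
        by (simp add: power_divide)
      finally show ?thesis .
    qed
  qed
  have "{g\<in>?\<Omega>. \<not> pair_rich_le m b N (adj m g)} \<subseteq> {g\<in>?\<Omega>. \<exists>i\<in>?J \<times> ?J'. ?Q i g}"
  proof (intro subsetI CollectI conjI)
    fix g assume g: "g \<in> {g\<in>?\<Omega>. \<not> pair_rich_le m b N (adj m g)}"
    then show "g \<in> ?\<Omega>" by blast
    from g obtain B where B: "B \<subseteq> {..<m}" "real (card B) \<le> b"
      "N \<le> card {z\<in>{..<m} - B. 2 \<le> card {y\<in>B. adj m g z y}}"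
      by (auto simp: pair_rich_le_def not_le)
    then obtain Z where Z: "Z \<subseteq> {z\<in>{..<m} - B. 2 \<le> card {y\<in>B. adj m g z y}}" "card Z = N"
      by (meson obtain_subset_with_card_n)
    have "finite B" using B(1) finite_subset by blast
    moreover have "finite Z" using Z(2) assms(4) card_gt_0_iff by blast
    ultimately have e: "edge_count (adj m g) Z B = (\<Sum>z\<in>Z. card {y\<in>B. adj m g z y})"
      by (simp add: edge_count_eq_sum)
    have "card Z * 2 \<le> (\<Sum>z\<in>Z. card {y\<in>B. adj m g z y})"
      using sum_bounded_below[of Z 2 "\<lambda>z. card {y\<in>B. adj m g z y}"] Z(1) by auto
    then have "2 * N \<le> edge_count (adj m g) Z B" using Z(2) e by simp
    then have "2 * real N \<le> real (edge_count (adj m g) Z B)" by linarith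
    then have "?Q (B, Z) g" using Z by auto
    moreover have "(B, Z) \<in> ?J \<times> ?J'" using B Z by auto
    ultimately show "\<exists>i\<in>?J \<times> ?J'. ?Q i g" by blast
  qed
  then have "real (card {g\<in>?\<Omega>. \<not> pair_rich_le m b N (adj m g)}) \<le> real (card {g\<in>?\<Omega>. \<exists>i\<in>?J \<times> ?J'. ?Q i g})"
    using fin by (intro of_nat_mono card_mono) auto
  also have "\<dots> \<le> (\<Sum>i\<in>?J \<times> ?J'. real q ^ card (pairs m) * (exp 1 / \<kappa>\<^sup>2) ^ N)"
    by (rule card_Bex_le[OF finI *])
  also have "\<dots> = real q ^ card (pairs m) * (real (card ?J) * (real (card ?J') * (exp 1 / \<kappa>\<^sup>2) ^ N))"
    by (simp add: card_cartesian_product)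
  also have "\<dots> \<le> real q ^ card (pairs m) * (exp (1 + real N) * exp (- 2 * real N))"
  proof (intro mult_left_mono mult_mono)
    have "real (card ?J) = (\<Sum>B\<in>?J. 1)" by simp
    also have "\<dots> \<le> (\<Sum>B\<in>?J. exp N * ?t B)"
    proof (rule sum_mono)
      fix B assume B: "B \<in> ?J"
      have "exp (ln m * card B) \<le> exp N"
        using B h2 assms(2) mult_left_mono[of "real (card B)" b "ln m"] by (simp add: mult.commute)
      moreover have "exp (ln m * card B) * ?t B = 1"
        using assms(2) exp_of_nat_mult[of "card B" "ln (real m)"]
        by (simp add: mult.commute power_divide)
      ultimately show "1 \<le> exp N * ?t B"
        by (metis mult_right_mono zero_le_divide_1_iff zero_le_power of_nat_0_le_iff)
    qed
    also have "\<dots> \<le> (\<Sum>B\<in>Pow {..<m}. exp N * ?t B)" by (rule sum_mono2) auto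
    also have "\<dots> \<le> exp N * exp 1"
      unfolding sum_distrib_left[symmetric] by (intro mult_left_mono sum_Pow_inverse_power_le) auto
    finally show "real (card ?J) \<le> exp (1 + real N)" by (simp add: exp_add mult.commute)
    show "real (card ?J') * (exp 1 / \<kappa>\<^sup>2) ^ N \<le> exp (- 2 * real N)"
    proof (cases "N \<le> m")
      case True
      have "real (card ?J') = real (m choose N)" by (simp add: n_subsets)
      also have "\<dots> \<le> (exp 1 * real m / real N) ^ N" by (rule binomial_le_exp_power) (use True assms in auto)
      finally have "real (card ?J') * (exp 1 / \<kappa>\<^sup>2) ^ N \<le> (exp 1 * real m / real N) ^ N * (exp 1 / \<kappa>\<^sup>2) ^ N"
        by (intro mult_right_mono) auto
      also have "\<dots> = (exp 1 * real m / real N * (exp 1 / \<kappa>\<^sup>2)) ^ N" by (simp only: power_mult_distrib)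
      also have "\<dots> \<le> exp (- 2) ^ N"
      proof (rule power_mono)
        have "exp 4 = exp 1 * exp 1 * exp (2::real)" by (simp flip: exp_add)
        then have "exp 1 * exp 1 * m * exp 2 \<le> N * \<kappa>\<^sup>2" using h3 by (simp add: mult_ac)
        then show "exp 1 * real m / real N * (exp 1 / \<kappa>\<^sup>2) \<le> exp (- 2)"
          using assms(3,4) by (simp add: exp_minus field_simps)
      qed auto
      also have "\<dots> = exp (- 2 * real N)" using exp_of_nat_mult[of N "-2::real"] by (simp add: mult.commute)
      finally show ?thesis .
    next
      case False
      have z: "card ?J' = 0" using False by (simp add: n_subsets binomial_eq_0)
      show ?thesis by (simp only: z) simp
    qed
  qed auto
  also have "exp (1 + real N) * exp (- 2 * real N) = exp (1 - real N)" by (simp flip: exp_add)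
  finally show ?thesis .
qed

subsection \<open>Pairs with a common neighbour\<close>

text \<open>Bonferroni's inequality: the excess of the sum over the size of the union is charged to
  the pairwise intersections, of which there are at most \<open>(card Z)^2\<close>.\<close>

lemma sum_card_le_card_UN:
  assumes "finite Z" "\<And>z. z \<in> Z \<Longrightarrow> finite (A z)" "0 \<le> c"
    and "\<And>z z'. z \<in> Z \<Longrightarrow> z' \<in> Z \<Longrightarrow> z \<noteq> z' \<Longrightarrow> real (card (A z \<inter> A z')) \<le> c"
  shows "(\<Sum>z\<in>Z. real (card (A z))) \<le> real (card (\<Union>z\<in>Z. A z)) + (real (card Z))\<^sup>2 * c"
  using assms
proof (induction Z rule: finite_induct)
  case empty
  then show ?case by simp
next
  case (insert z Z)
  let ?U = "\<Union>z\<in>Z. A z"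
  have fin: "finite (A z)" "finite ?U" using insert.prems insert.hyps(1) by auto
  have "real (card (A z \<inter> ?U)) \<le> real (\<Sum>z'\<in>Z. card (A z \<inter> A z'))"
    unfolding Int_UN_distrib by (rule of_nat_mono[OF card_UN_le[OF insert.hyps(1)]])
  also have "\<dots> = (\<Sum>z'\<in>Z. real (card (A z \<inter> A z')))" by simp
  also have "\<dots> \<le> (\<Sum>z'\<in>Z. c)"
    using insert.hyps(2) by (intro sum_mono insert.prems(3)) auto
  finally have 1: "real (card (A z \<inter> ?U)) \<le> real (card Z) * c" by simp
  have 2: "real (card (A z)) + real (card ?U) = real (card (A z \<union> ?U)) + real (card (A z \<inter> ?U))"
    using card_Un_Int[OF fin] by linarith
  have 3: "(\<Sum>z\<in>Z. real (card (A z))) \<le> real (card ?U) + (real (card Z))\<^sup>2 * c"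
    by (rule insert.IH) (use insert.prems in auto)
  have "(real (card Z))\<^sup>2 * c + real (card Z) * c \<le> (real (card (insert z Z)))\<^sup>2 * c"
    using insert.hyps insert.prems(2) unfolding distrib_right[symmetric]
    by (intro mult_right_mono) (auto simp: power2_eq_square algebra_simps)
  then show ?case using 1 2 3 insert.hyps by simp
qed

lemma card_UN_le_real:
  assumes "finite I" "\<And>i. i \<in> I \<Longrightarrow> real (card (A i)) \<le> b i"
  shows "real (card (\<Union>i\<in>I. A i)) \<le> (\<Sum>i\<in>I. b i)"
proof -
  have "real (card (\<Union>i\<in>I. A i)) \<le> real (\<Sum>i\<in>I. card (A i))"
    by (rule of_nat_mono[OF card_UN_le[OF assms(1)]])
  also have "\<dots> = (\<Sum>i\<in>I. real (card (A i)))" by simp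
  also have "\<dots> \<le> (\<Sum>i\<in>I. b i)" by (rule sum_mono[OF assms(2)])
  finally show ?thesis .
qed

lemma card_UN_le_const:
  assumes "finite I" "\<And>i. i \<in> I \<Longrightarrow> real (card (A i)) \<le> c" "real (card I) \<le> d" "0 \<le> c"
  shows "real (card (\<Union>i\<in>I. A i)) \<le> d * c"
proof -
  have "real (card (\<Union>i\<in>I. A i)) \<le> (\<Sum>i\<in>I. c)" by (rule card_UN_le_real[OF assms(1,2)])
  also have "\<dots> \<le> d * c" using assms(3,4) by (simp add: mult_right_mono)
  finally show ?thesis .
qed

lemma card_vimage_fibres_le:
  assumes "finite T" "finite Y" "\<And>y. y \<in> Y \<Longrightarrow> real (card {u\<in>T. f u = y}) \<le> s"
  shows "real (card {u\<in>T. f u \<in> Y}) \<le> s * card Y"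
proof -
  have "{u\<in>T. f u \<in> Y} = (\<Union>y\<in>Y. {u\<in>T. f u = y})" by blast
  moreover have "real (card (\<Union>y\<in>Y. {u\<in>T. f u = y})) \<le> (\<Sum>y\<in>Y. s)"
    by (rule card_UN_le_real) (use assms in auto)
  ultimately show ?thesis by (simp add: mult.commute)
qed

text \<open>Pairs in a common fibre, including those on the diagonal, belong to this set as soon as their
  block has a neighbour.\<close>

definition common_pairs :: "(nat \<Rightarrow> nat \<Rightarrow> bool) \<Rightarrow> ('v \<Rightarrow> nat) \<Rightarrow> 'v set \<Rightarrow> ('v \<times> 'v) set" where
  "common_pairs R f T = {(u, v). u \<in> T \<and> v \<in> T \<and> (\<exists>z. R z (f u) \<and> R z (f v))}"

text \<open>The main term \<open>s * \<Delta> * a\<close> comes from the block vertices \<open>z\<close> whose blown-up neighbourhood meets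
  \<open>T\<close> in at least \<open>h\<close> points: these intersections are almost disjoint by Bonferroni. The other
  \<open>z\<close> with at least \<open>x\<close> neighbouring blocks are few. A \<open>z\<close> with fewer neighbouring blocks matters only
  through pairs in different blocks; either one of the two blocks holds less than \<open>W\<close> points of \<open>T\<close>,
  or \<open>z\<close> sees two of the at most \<open>b\<close> heavy blocks.\<close>

lemma card_common_pairs_le:
  fixes R :: "nat \<Rightarrow> nat \<Rightarrow> bool" and f :: "'v \<Rightarrow> nat" and s \<Delta> x K b h W :: real
  assumes T: "finite T" "card T \<le> a" "f ` T \<subseteq> {..<m}"
    and R: "\<And>x y. R x y \<Longrightarrow> R y x" "\<And>x y. R x y \<Longrightarrow> x < m \<and> y < m"
    and deg: "max_degree_le m \<Delta> R" and codeg: "codegree_le m D R"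
    and rich: "rich_sum_le m a x K R" and prich: "pair_rich_le m b N R"
    and fibre: "\<And>y. real (card {u\<in>T. f u = y}) \<le> s"
    and pos: "0 < s" "0 \<le> \<Delta>" "0 \<le> x" "0 \<le> K" "0 < W" "0 < h"
    and h: "x * s \<le> h" and W: "a \<le> b * W"
  shows "real (card (common_pairs R f T))
    \<le> s * \<Delta> * a + (s * a + s * \<Delta> * ((s * K * a / h)\<^sup>2 * (s * D)) + h * (s * K * a)
        + 2 * (a * (\<Delta> * (W * x))) + (N + b) * (s * x)\<^sup>2)"
proof -
  let ?B = "f ` T"
  define Tz where "Tz z = {u\<in>T. R z (f u)}" for z
  define X where "X z = real (card (Tz z))" for z
  define e where "e z = card {y\<in>?B. R z y}" for z
  define w where "w y = real (card {u\<in>T. f u = y})" for y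
  define big where "big = {z\<in>{..<m}. h \<le> X z}"
  define rch where "rch = {z\<in>{..<m}. x \<le> real (e z)}"
  define poor where "poor = {..<m} - rch"
  define H where "H = {y\<in>?B. W \<le> w y}"
  define two where "two = {z\<in>{..<m}. 2 \<le> card {y\<in>H. R z y}}"
  have finB: "finite ?B" using T by simp
  have cardB: "card ?B \<le> a" using card_image_le[OF T(1), of f] T(2) by linarith
  have finTz: "finite (Tz z)" for z using T by (simp add: Tz_def)
  have fins: "finite big" "finite rch" "finite poor" "finite H" "finite two"
    using finB by (auto simp: big_def rch_def poor_def H_def two_def)
  have ra: "real (card T) \<le> real a" using T(2) by simp
  have Xe: "X z \<le> s * e z" for z
  proof -
    have "Tz z = {u\<in>T. f u \<in> {y\<in>?B. R z y}}" by (auto simp: Tz_def)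
    then show ?thesis unfolding X_def e_def
      using card_vimage_fibres_le[OF T(1), of "{y\<in>?B. R z y}" f s] fibre finB by simp
  qed
  have X\<Delta>: "X z \<le> s * \<Delta>" for z
  proof (cases "z < m")
    case True
    have "Tz z = {u\<in>T. f u \<in> {y\<in>{..<m}. R z y}}" using T(3) by (auto simp: Tz_def)
    then have "X z \<le> s * card {y\<in>{..<m}. R z y}" unfolding X_def
      using card_vimage_fibres_le[OF T(1), of "{y\<in>{..<m}. R z y}" f s] fibre by simp
    also have "\<dots> \<le> s * \<Delta>"
      using deg True pos(1) by (intro mult_left_mono) (auto simp: max_degree_le_def)
    finally show ?thesis .
  next
    case False
    then have "Tz z = {}" using R(2) by (auto simp: Tz_def)
    then show ?thesis using pos by (simp add: X_def)
  qed
  have codeg': "real (card (Tz z \<inter> Tz z')) \<le> s * D" if "z < m" "z' < m" "z \<noteq> z'" for z z'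
  proof -
    have "Tz z \<inter> Tz z' = {u\<in>T. f u \<in> {y\<in>{..<m}. R z y \<and> R z' y}}" using T(3) by (auto simp: Tz_def)
    then have "real (card (Tz z \<inter> Tz z')) \<le> s * card {y\<in>{..<m}. R z y \<and> R z' y}"
      using card_vimage_fibres_le[OF T(1), of "{y\<in>{..<m}. R z y \<and> R z' y}" f s] fibre by simp
    also have "\<dots> \<le> s * D"
      using codeg that pos(1) by (intro mult_left_mono) (auto simp: codegree_le_def)
    finally show ?thesis .
  qed
  have big_rch: "big \<subseteq> rch"
  proof
    fix z assume z: "z \<in> big"
    then have "x * s \<le> s * e z" using h Xe[of z] by (auto simp: big_def)
    then have "x \<le> real (e z)" using pos(1) by (simp add: mult.commute)
    then show "z \<in> rch" using z by (auto simp: big_def rch_def)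
  qed
  have sum_e: "(\<Sum>z\<in>rch. real (e z)) \<le> K * a"
  proof -
    have "real (\<Sum>z\<in>rch. e z) \<le> K * a"
      using rich T(3) cardB unfolding rich_sum_le_def rch_def e_def by blast
    then show ?thesis by simp
  qed
  have sumX: "(\<Sum>z\<in>Z. X z) \<le> s * K * a" if "Z \<subseteq> rch" for Z
  proof -
    have "(\<Sum>z\<in>Z. X z) \<le> (\<Sum>z\<in>rch. X z)"
      using that fins by (intro sum_mono2) (auto simp: X_def)
    also have "\<dots> \<le> (\<Sum>z\<in>rch. s * real (e z))" by (intro sum_mono Xe)
    also have "\<dots> = s * (\<Sum>z\<in>rch. real (e z))" by (simp add: sum_distrib_left)
    also have "\<dots> \<le> s * (K * a)" using sum_e pos by (intro mult_left_mono) auto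
    finally show ?thesis by (simp add: mult.assoc)
  qed
  have card_big: "real (card big) \<le> s * K * a / h"
  proof -
    have "real (card big) * h = (\<Sum>z\<in>big. h)" by simp
    also have "\<dots> \<le> (\<Sum>z\<in>big. X z)" by (rule sum_mono) (auto simp: big_def)
    also have "\<dots> \<le> s * K * a" by (rule sumX[OF big_rch])
    finally show ?thesis using pos by (simp add: field_simps)
  qed
  have sum_big: "(\<Sum>z\<in>big. X z) \<le> a + (s * K * a / h)\<^sup>2 * (s * D)"
  proof -
    have "(\<Sum>z\<in>big. X z) \<le> real (card (\<Union>z\<in>big. Tz z)) + (real (card big))\<^sup>2 * (s * D)"
      unfolding X_def by (rule sum_card_le_card_UN) (use fins finTz codeg' pos in \<open>auto simp: big_def\<close>)
    also have "\<dots> \<le> a + (s * K * a / h)\<^sup>2 * (s * D)"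
    proof (intro add_mono mult_right_mono power_mono card_big)
      have "card (\<Union>z\<in>big. Tz z) \<le> card T" using T(1) by (intro card_mono) (auto simp: Tz_def)
      then show "real (card (\<Union>z\<in>big. Tz z)) \<le> a" using T(2) by simp
    qed (use pos in auto)
    finally show ?thesis .
  qed
  have sq: "real (card (Tz z \<times> Tz z)) = X z * X z" for z by (simp add: X_def card_cartesian_product)
  have X0: "0 \<le> X z" for z by (simp add: X_def)
  \<comment> \<open>The parts of the cover: pairs in a common fibre; pairs seen by a big
    \<open>z\<close>; by a rich \<open>z\<close> that is not big; by a poor \<open>z\<close> where
    the second point lies in a light block; by a poor \<open>z\<close> with two heavy neighbouring
    blocks. \<open>Clight\<close> is one-sided, so the cover also uses its image under
    \<open>prod.swap\<close>.\<close>
  define C0 where "C0 = (SIGMA u:T. {v\<in>T. f v = f u})"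
  define Cbig where "Cbig = (\<Union>z\<in>big. Tz z \<times> Tz z)"
  define Cmid where "Cmid = (\<Union>z\<in>rch - big. Tz z \<times> Tz z)"
  define Clight where "Clight = (SIGMA u:T. \<Union>z\<in>{z\<in>poor. R (f u) z}. {v\<in>T. f v \<in> {y\<in>?B. R z y \<and> w y < W}})"
  define Cheavy where "Cheavy = (\<Union>z\<in>two \<inter> poor. Tz z \<times> Tz z)"
  have c0: "real (card C0) \<le> s * a"
  proof -
    have "real (card C0) = (\<Sum>u\<in>T. real (card {v\<in>T. f v = f u}))"
      unfolding C0_def using T(1) by (subst card_SigmaI) auto
    also have "\<dots> \<le> (\<Sum>u\<in>T. s)" by (intro sum_mono fibre)
    also have "\<dots> \<le> s * a" using ra pos(1) by (simp add: mult.commute mult_left_mono)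
    finally show ?thesis .
  qed
  have cbig: "real (card Cbig) \<le> s * \<Delta> * (a + (s * K * a / h)\<^sup>2 * (s * D))"
  proof -
    have "real (card Cbig) \<le> (\<Sum>z\<in>big. s * \<Delta> * X z)"
      unfolding Cbig_def by (rule card_UN_le_real) (use fins X\<Delta> X0 in \<open>auto simp: sq intro!: mult_right_mono\<close>)
    also have "\<dots> = s * \<Delta> * (\<Sum>z\<in>big. X z)" by (simp add: sum_distrib_left)
    also have "\<dots> \<le> s * \<Delta> * (a + (s * K * a / h)\<^sup>2 * (s * D))"
      using pos by (intro mult_left_mono sum_big) auto
    finally show ?thesis .
  qed
  have cmid: "real (card Cmid) \<le> h * (s * K * a)"
  proof -
    have "real (card Cmid) \<le> (\<Sum>z\<in>rch - big. h * X z)"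
      unfolding Cmid_def
      by (rule card_UN_le_real) (use fins X0 in \<open>auto simp: sq big_def rch_def intro!: mult_right_mono\<close>)
    also have "\<dots> = h * (\<Sum>z\<in>rch - big. X z)" by (simp add: sum_distrib_left)
    also have "\<dots> \<le> h * (s * K * a)" using pos by (intro mult_left_mono sumX) auto
    finally show ?thesis .
  qed
  have clight: "real (card Clight) \<le> a * (\<Delta> * (W * x))"
  proof -
    have inner: "real (card {v\<in>T. f v \<in> {y\<in>?B. R z y \<and> w y < W}}) \<le> W * x" if "z \<in> poor" for z
    proof -
      have "real (card {v\<in>T. f v \<in> {y\<in>?B. R z y \<and> w y < W}}) \<le> W * card {y\<in>?B. R z y \<and> w y < W}"
        by (rule card_vimage_fibres_le) (use T finB in \<open>auto simp: w_def\<close>)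
      also have "\<dots> \<le> W * e z"
        using finB pos unfolding e_def by (intro mult_left_mono of_nat_mono card_mono) auto
      also have "\<dots> \<le> W * x" using that pos by (intro mult_left_mono) (auto simp: poor_def rch_def)
      finally show ?thesis .
    qed
    have "real (card (\<Union>z\<in>{z\<in>poor. R (f u) z}. {v\<in>T. f v \<in> {y\<in>?B. R z y \<and> w y < W}})) \<le> \<Delta> * (W * x)"
      if "u \<in> T" for u
    proof (rule card_UN_le_const)
      have "card {z\<in>poor. R (f u) z} \<le> card {y\<in>{..<m}. R (f u) y}"
        by (intro card_mono) (auto simp: poor_def)
      moreover have "real (card {y\<in>{..<m}. R (f u) y}) \<le> \<Delta>"
        using deg that T(3) by (auto simp: max_degree_le_def)
      ultimately show "real (card {z\<in>poor. R (f u) z}) \<le> \<Delta>" by linarith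
    qed (use fins inner pos in auto)
    then have "(\<Sum>u\<in>T. real (card (\<Union>z\<in>{z\<in>poor. R (f u) z}. {v\<in>T. f v \<in> {y\<in>?B. R z y \<and> w y < W}}))) \<le> (\<Sum>u\<in>T. \<Delta> * (W * x))"
      by (rule sum_mono)
    also have "\<dots> \<le> a * (\<Delta> * (W * x))" using ra pos by (simp add: mult_right_mono)
    finally show ?thesis
      unfolding Clight_def using T(1) fins by (subst card_SigmaI) auto
  qed
  have card_H: "real (card H) \<le> b"
  proof -
    have "real (card H) * W = (\<Sum>y\<in>H. W)" by simp
    also have "\<dots> \<le> (\<Sum>y\<in>H. real (card {u\<in>T. f u = y}))" by (rule sum_mono) (auto simp: H_def w_def)
    also have "\<dots> = real (card (\<Union>y\<in>H. {u\<in>T. f u = y}))"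
      using fins T(1) by (subst card_UN_disjoint) auto
    also have "\<dots> \<le> real (card T)" using T(1) by (intro of_nat_mono card_mono) auto
    also have "\<dots> \<le> b * W" using ra W by linarith
    finally show ?thesis using pos by simp
  qed
  have card_two: "real (card two) \<le> N + b"
  proof -
    \<comment> \<open>\<open>pair_rich_le\<close> is silent about \<open>z\<close> in
      \<open>H\<close>; these are simply added, at most \<open>b\<close> of them.\<close>
    have "two \<subseteq> {z\<in>{..<m} - H. 2 \<le> card {y\<in>H. R z y}} \<union> H" by (auto simp: two_def)
    then have "card two \<le> card ({z\<in>{..<m} - H. 2 \<le> card {y\<in>H. R z y}} \<union> H)"
      using fins by (intro card_mono) auto
    also have "\<dots> \<le> card {z\<in>{..<m} - H. 2 \<le> card {y\<in>H. R z y}} + card H" by (rule card_Un_le)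
    also have "card {z\<in>{..<m} - H. 2 \<le> card {y\<in>H. R z y}} \<le> N"
    proof -
      have "H \<subseteq> {..<m}" using T(3) by (auto simp: H_def)
      then show ?thesis using prich card_H unfolding pair_rich_le_def by blast
    qed
    finally show ?thesis using card_H by linarith
  qed
  have cheavy: "real (card Cheavy) \<le> (N + b) * (s * x)\<^sup>2"
    unfolding Cheavy_def
  proof (rule card_UN_le_const)
    fix z assume "z \<in> two \<inter> poor"
    then have "real (e z) \<le> x" by (auto simp: poor_def rch_def)
    then have "X z \<le> s * x" using Xe[of z] pos(1) by (smt (verit) mult_left_mono)
    then show "real (card (Tz z \<times> Tz z)) \<le> (s * x)\<^sup>2"
      unfolding sq power2_eq_square using X0 by (intro mult_mono) (auto intro: order_trans)
  next
    have "card (two \<inter> poor) \<le> card two" using fins by (intro card_mono) auto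
    then show "real (card (two \<inter> poor)) \<le> real N + b" using card_two by linarith
  qed (use fins in auto)
  have cover: "common_pairs R f T \<subseteq> C0 \<union> Cbig \<union> Cmid \<union> Clight \<union> prod.swap ` Clight \<union> Cheavy"
  proof (clarify)
    fix u v assume uv: "(u, v) \<in> common_pairs R f T" "(u, v) \<notin> Cheavy" "(u, v) \<notin> prod.swap ` Clight"
      "(u, v) \<notin> Clight" "(u, v) \<notin> Cmid" "(u, v) \<notin> Cbig"
    then obtain z where z: "u \<in> T" "v \<in> T" "R z (f u)" "R z (f v)" by (auto simp: common_pairs_def)
    then have zm: "z < m" and uz: "u \<in> Tz z" "v \<in> Tz z" using R(2) by (auto simp: Tz_def)
    then have "z \<notin> big" "z \<notin> rch - big" using uv by (auto simp: Cbig_def Cmid_def)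
    then have poor: "z \<in> poor" using zm by (auto simp: poor_def)
    have "W \<le> w (f v)"
    proof (rule ccontr)
      assume "\<not> W \<le> w (f v)"
      then have "(u, v) \<in> Clight" unfolding Clight_def using z poor R(1)[OF z(3)] by auto
      then show False using uv by blast
    qed
    moreover have "W \<le> w (f u)"
    proof (rule ccontr)
      assume "\<not> W \<le> w (f u)"
      then have "(v, u) \<in> Clight" unfolding Clight_def using z poor R(1)[OF z(4)] by auto
      then have "(u, v) \<in> prod.swap ` Clight" by force
      then show False using uv by blast
    qed
    ultimately have sub: "{f u, f v} \<subseteq> {y\<in>H. R z y}" using z by (auto simp: H_def)
    have "f u = f v"
    proof (rule ccontr)
      assume ne: "f u \<noteq> f v"
      have "card {f u, f v} \<le> card {y\<in>H. R z y}" using sub fins by (intro card_mono) auto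
      then have "z \<in> two" using ne zm by (auto simp: two_def)
      then have "(u, v) \<in> Cheavy" using uz poor by (auto simp: Cheavy_def)
      then show False using uv by blast
    qed
    then show "(u, v) \<in> C0" using z by (auto simp: C0_def)
  qed
  have finC: "finite C0" "finite Cbig" "finite Cmid" "finite Clight" "finite Cheavy"
    using T(1) fins finTz by (auto simp: C0_def Cbig_def Cmid_def Clight_def Cheavy_def)
  have "card (common_pairs R f T) \<le> card (C0 \<union> Cbig \<union> Cmid \<union> Clight \<union> prod.swap ` Clight \<union> Cheavy)"
    using finC by (intro card_mono cover) auto
  also have "\<dots> \<le> card C0 + card Cbig + card Cmid + card Clight + card (prod.swap ` Clight) + card Cheavy"
    by (meson card_Un_le add_le_mono order_trans order_refl)
  also have "card (prod.swap ` Clight) = card Clight" by (rule card_image) auto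
  finally have "real (card (common_pairs R f T)) \<le> real (card C0) + real (card Cbig) + real (card Cmid)
      + real (card Clight) + real (card Clight) + real (card Cheavy)"
    by linarith
  also have "\<dots> \<le> s * a + s * \<Delta> * (a + (s * K * a / h)\<^sup>2 * (s * D)) + h * (s * K * a)
      + a * (\<Delta> * (W * x)) + a * (\<Delta> * (W * x)) + (N + b) * (s * x)\<^sup>2"
    by (intro add_mono c0 cbig cmid clight cheavy)
  finally show ?thesis by (simp add: algebra_simps)
qed

subsection \<open>The two-bite graph\<close>

text \<open>Inside one block graph only the two larger vertices of a triangle lose their edge. Thus, when the
  edges are exposed by their smaller end, an edge is known to be closed or not before it is exposed.\<close>

definition surviving :: "(nat \<Rightarrow> nat \<Rightarrow> bool) \<Rightarrow> (nat \<Rightarrow> nat \<Rightarrow> bool) \<Rightarrow> ('v \<Rightarrow> nat) \<Rightarrow> ('v \<Rightarrow> nat) \<Rightarrow> 'v \<Rightarrow> 'v \<Rightarrow> bool"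
  where "surviving R R' f f' u v \<longleftrightarrow> R (f u) (f v)
    \<and> \<not> (\<exists>z<min (f u) (f v). R z (f u) \<and> R z (f v))
    \<and> \<not> (\<exists>z. R' z (f' u) \<and> R' z (f' v))"

text \<open>Here \<open>R'\<close> is fixed and only \<open>g\<close> is random. As \<open>f\<close>
  is injective on \<open>T\<close>, distinct pairs of \<open>T\<close> use distinct bits. If no pair
  survives, every open position carries a nonzero bit. Openness of \<open>(x, y)\<close> reads only
  bits \<open>(z, x)\<close> and \<open>(z, y)\<close> with \<open>z < x\<close>, so
  \<open>fst\<close> serves as the rank. The closed pairs are counted as ordered pairs, whence the
  factor 2 before \<open>U\<close>.\<close>

lemma card_no_surviving_le:
  fixes c c' U :: real
  assumes q: "1 < q" and T: "finite T" "card T = a" "f ` T \<subseteq> {..<m}" "inj_on f T"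
    and c': "real (card (common_pairs R' f' T)) \<le> c'"
    and U: "2 * U \<le> real a * real a - a - c - c'"
  shows "real (card {g\<in>pairs m \<rightarrow>\<^sub>E {..<q}. real (card (common_pairs (adj m g) f T)) \<le> c
      \<and> (\<forall>u\<in>T. \<forall>v\<in>T. \<not> surviving (adj m g) R' f f' u v)})
    \<le> real q ^ card (pairs m) * exp (- U / q)"
proof -
  let ?\<Omega> = "pairs m \<rightarrow>\<^sub>E {..<q}"
  define h where "h = the_inv_into T f"
  have h: "h (f u) = u" if "u \<in> T" for u using T(4) that by (simp add: h_def the_inv_into_f_f)
  define P where "P = {(f u, f v) | u v. u \<in> T \<and> v \<in> T \<and> f u < f v}"
  \<comment> \<open>The inverse \<open>h\<close> recovers the vertex from its block, so that closure
    by \<open>R'\<close> becomes a property of the position.\<close>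
  define opn :: "(nat \<times> nat \<Rightarrow> nat) \<Rightarrow> nat \<times> nat \<Rightarrow> bool" where
    "opn g e \<longleftrightarrow> \<not> (\<exists>z<fst e. g (z, fst e) = 0 \<and> g (z, snd e) = 0)
       \<and> \<not> (\<exists>z. R' z (f' (h (fst e))) \<and> R' z (f' (h (snd e))))" for g e
  have P: "P \<subseteq> pairs m" using T(3) by (auto simp: P_def pairs_def)
  have common_finite: "finite (common_pairs R f T)" for R and f :: "'a \<Rightarrow> nat"
    by (rule finite_subset[of _ "T \<times> T"]) (use T(1) in \<open>auto simp: common_pairs_def\<close>)
  have "{g\<in>?\<Omega>. real (card (common_pairs (adj m g) f T)) \<le> c
      \<and> (\<forall>u\<in>T. \<forall>v\<in>T. \<not> surviving (adj m g) R' f f' u v)}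
    \<subseteq> {g\<in>?\<Omega>. (\<forall>e\<in>P. opn g e \<longrightarrow> g e \<noteq> 0) \<and> U \<le> real (card {e\<in>P. opn g e})}"
  proof (intro subsetI CollectI conjI ballI impI)
    fix g assume g: "g \<in> {g\<in>?\<Omega>. real (card (common_pairs (adj m g) f T)) \<le> c
      \<and> (\<forall>u\<in>T. \<forall>v\<in>T. \<not> surviving (adj m g) R' f f' u v)}"
    then show "g \<in> ?\<Omega>" by blast
    have adj: "adj m g x y \<longleftrightarrow> g (x, y) = 0" if "x < y" "y < m" for x y
      using that by (auto simp: adj_def)
    show "g e \<noteq> 0" if e: "e \<in> P" "opn g e" for e
    proof
      assume ge: "g e = 0"
      obtain u v where uv: "e = (f u, f v)" "u \<in> T" "v \<in> T" "f u < f v" using e(1) by (auto simp: P_def)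
      have m: "f u < m" "f v < m" using uv T(3) by auto
      have "surviving (adj m g) R' f f' u v"
        unfolding surviving_def
      proof (intro conjI notI)
        show "adj m g (f u) (f v)" using adj[OF uv(4) m(2)] ge uv(1) by simp
        assume "\<exists>z<min (f u) (f v). adj m g z (f u) \<and> adj m g z (f v)"
        then obtain z where z: "z < f u" "adj m g z (f u)" "adj m g z (f v)" by auto
        then have "g (z, f u) = 0" "g (z, f v) = 0" using adj[of z "f u"] adj[of z "f v"] m uv(4) by auto
        then show False using e(2) z(1) by (auto simp: opn_def uv(1))
      next
        assume "\<exists>z. R' z (f' u) \<and> R' z (f' v)"
        then show False using e(2) uv h by (auto simp: opn_def)
      qed
      then show False using g uv by blast
    qed
    let ?c = "common_pairs (adj m g) f T" and ?c' = "common_pairs R' f' T"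
    let ?O = "{(u, v). u \<in> T \<and> v \<in> T \<and> (f u, f v) \<in> P \<and> opn g (f u, f v)}"
    have finO: "finite ?O" by (rule finite_subset[of _ "T \<times> T"]) (use T(1) in auto)
    have finP: "finite {e\<in>P. opn g e}" using finite_subset[OF P finite_pairs] by simp
    have "inj_on (\<lambda>(u, v). (f u, f v)) ?O"
      using T(4) by (auto simp: inj_on_def)
    then have "card ?O = card ((\<lambda>(u, v). (f u, f v)) ` ?O)" by (simp only: card_image)
    also have "\<dots> \<le> card {e\<in>P. opn g e}" by (rule card_mono[OF finP]) auto
    finally have cardO: "card ?O \<le> card {e\<in>P. opn g e}" .
    have up: "(u, v) \<in> ?O" if "u \<in> T" "v \<in> T" "f u < f v" "(u, v) \<notin> ?c" "(u, v) \<notin> ?c'" for u v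
    proof -
      have m: "f u < m" "f v < m" using that T(3) by auto
      have False if "z < f u" "g (z, f u) = 0" "g (z, f v) = 0" for z
      proof -
        have "adj m g z (f u)" "adj m g z (f v)" using adj[of z "f u"] adj[of z "f v"] m \<open>f u < f v\<close> that by auto
        then show False using \<open>(u, v) \<notin> ?c\<close> \<open>u \<in> T\<close> \<open>v \<in> T\<close> by (auto simp: common_pairs_def)
      qed
      then show ?thesis using that h by (auto simp: opn_def P_def common_pairs_def)
    qed
    \<comment> \<open>An ordered pair is on the diagonal, or has a common neighbour in one of the
      two block graphs, or is open in one of its two orientations.\<close>
    have "T \<times> T \<subseteq> (\<lambda>u. (u, u)) ` T \<union> ?c \<union> ?c' \<union> ?O \<union> prod.swap ` ?O"
    proof (rule subrelI)
      fix u v assume uv: "(u, v) \<in> T \<times> T"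
      show "(u, v) \<in> (\<lambda>u. (u, u)) ` T \<union> ?c \<union> ?c' \<union> ?O \<union> prod.swap ` ?O"
      proof (cases "(u, v) \<in> ?c \<union> ?c'")
        case False
        then have F': "(v, u) \<notin> ?c" "(v, u) \<notin> ?c'" by (auto simp: common_pairs_def)
        consider "u = v" | "f u < f v" | "f v < f u"
          using T(4) uv by (metis inj_onD linorder_neqE_nat mem_Sigma_iff)
        then show ?thesis
        proof cases
          case 1
          then show ?thesis using uv by auto
        next
          case 2
          then have "(u, v) \<in> ?O" using up uv False by blast
          then show ?thesis by blast
        next
          case 3
          then have "(v, u) \<in> ?O" using up uv F' by blast
          then have "prod.swap (v, u) \<in> prod.swap ` ?O" by (rule imageI)
          then show ?thesis by simp
        qed
      qed auto
    qed
    then have "card (T \<times> T) \<le> card ((\<lambda>u. (u, u)) ` T \<union> ?c \<union> ?c' \<union> ?O \<union> prod.swap ` ?O)"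
      using T(1) common_finite finO by (intro card_mono) auto
    also have "\<dots> \<le> card ((\<lambda>u. (u, u)) ` T) + card ?c + card ?c' + card ?O + card (prod.swap ` ?O)"
      by (meson card_Un_le add_le_mono order_trans order_refl)
    also have "card ((\<lambda>u. (u, u)) ` T) \<le> a" using card_image_le[OF T(1)] T(2) by blast
    also have "card (prod.swap ` ?O) \<le> card ?O" by (rule card_image_le[OF finO])
    finally have "a * a \<le> a + card ?c + card ?c' + card {e\<in>P. opn g e} + card {e\<in>P. opn g e}"
      using cardO by (simp add: card_cartesian_product T(2))
    then have "real (a * a) \<le> real (a + card ?c + card ?c' + card {e\<in>P. opn g e} + card {e\<in>P. opn g e})"
      by (rule of_nat_mono)
    moreover have "real (card ?c) \<le> c" using g by blast
    ultimately show "U \<le> real (card {e\<in>P. opn g e})" using c' U by simp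
  qed
  then have "real (card {g\<in>?\<Omega>. real (card (common_pairs (adj m g) f T)) \<le> c
      \<and> (\<forall>u\<in>T. \<forall>v\<in>T. \<not> surviving (adj m g) R' f f' u v)})
    \<le> real (card {g\<in>?\<Omega>. (\<forall>e\<in>P. opn g e \<longrightarrow> g e \<noteq> 0) \<and> U \<le> real (card {e\<in>P. opn g e})})"
    using finite_lessThan_PiE[OF finite_pairs] by (intro of_nat_mono card_mono) auto
  also have "\<dots> \<le> real q ^ card (pairs m) * exp (- U / q)"
  proof (rule card_no_open_zero_le[where rank = fst])
    fix g g' :: "nat \<times> nat \<Rightarrow> nat" and e
    assume e: "e \<in> P" and eq: "\<And>d. d \<in> pairs m \<Longrightarrow> fst d < fst e \<Longrightarrow> g d = g' d"
    have "g (z, fst e) = g' (z, fst e)" "g (z, snd e) = g' (z, snd e)" if "z < fst e" for z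
      using that e P by (auto intro!: eq simp: pairs_def)
    then show "opn g e = opn g' e" by (auto simp: opn_def)
  qed (use finite_pairs q P in auto)
  finally show ?thesis .
qed

definition two_bite :: "nat \<Rightarrow> (nat \<Rightarrow> nat \<Rightarrow> bool) \<Rightarrow> (nat \<Rightarrow> nat \<Rightarrow> bool) \<Rightarrow> (nat \<Rightarrow> nat) \<Rightarrow> (nat \<Rightarrow> nat) \<Rightarrow> nat pair_pre_digraph"
  where "two_bite n R R' f f' = \<lparr> pverts = {..<n},
    parcs = {(u, v). u < n \<and> v < n \<and> (surviving R R' f f' u v \<or> surviving R' R f' f u v)} \<rparr>"

lemma surviving_sym:
  assumes "\<And>x y. R x y \<Longrightarrow> R y x" "surviving R R' f f' u v"
  shows "surviving R R' f f' v u"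
  using assms by (auto simp: surviving_def min.commute)

lemma pair_graph_two_bite:
  assumes "\<And>x y. R x y \<Longrightarrow> R y x" "\<And>x. \<not> R x x" "\<And>x y. R' x y \<Longrightarrow> R' y x" "\<And>x. \<not> R' x x"
  shows "pair_graph (two_bite n R R' f f')"
proof
  show "finite (parcs (two_bite n R R' f f'))"
    by (rule finite_subset[of _ "{..<n} \<times> {..<n}"]) (auto simp: two_bite_def)
  have "sym (parcs (two_bite n R R' f f'))"
    using surviving_sym[of R R' f f', OF assms(1)] surviving_sym[of R' R f' f, OF assms(3)]
    by (auto simp: sym_def two_bite_def)
  then show "symmetric (with_proj (two_bite n R R' f f'))"
    by (simp add: symmetric_def arcs_ends_def arc_to_ends_def)
  show "fst e \<noteq> snd e" if "e \<in> parcs (two_bite n R R' f f')" for e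
    using that assms(2,4) by (auto simp: two_bite_def surviving_def)
qed (auto simp: two_bite_def)

text \<open>The block \<open>f w\<close> is a common \<open>R\<close>-neighbour of
  \<open>f u\<close> and \<open>f v\<close>, and such a neighbour deletes the edge of the other
  blow-up. Hence no triangle takes two edges from one blow-up and the third from the other.\<close>

lemma surviving_path_closes:
  assumes sym: "\<And>x y. R x y \<Longrightarrow> R y x"
    and "surviving R R' f f' u w" "surviving R R' f f' w v"
  shows "\<not> surviving R' R f' f u v"
  using assms by (auto simp: surviving_def)

text \<open>Irreflexivity makes the three blocks distinct; the smallest of them then deletes the
  edge between the other two.\<close>

lemma no_surviving_triangle:
  assumes sym: "\<And>x y. R x y \<Longrightarrow> R y x" and irrefl: "\<And>x. \<not> R x x"
    and uv: "surviving R R' f f' u v" and vw: "surviving R R' f f' v w" and wu: "surviving R R' f f' w u"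
  shows False
proof -
  have R: "R (f u) (f v)" "R (f v) (f w)" "R (f w) (f u)" "R (f v) (f u)" "R (f w) (f v)" "R (f u) (f w)"
    using uv vw wu sym by (auto simp: surviving_def)
  then have "f u \<noteq> f v" "f v \<noteq> f w" "f w \<noteq> f u" using irrefl by metis+
  then consider "f w < min (f u) (f v)" | "f u < min (f v) (f w)" | "f v < min (f w) (f u)"
    by linarith
  then show False
    using uv vw wu R by cases (auto simp: surviving_def)
qed

lemma triangle_free_two_bite:
  assumes R: "\<And>x y. R x y \<Longrightarrow> R y x" "\<And>x. \<not> R x x"
    and R': "\<And>x y. R' x y \<Longrightarrow> R' y x" "\<And>x. \<not> R' x x"
  shows "triangle_free (two_bite n R R' f f')"
  unfolding triangle_free_def
proof (intro notI, elim exE conjE)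
  fix u v w
  let ?S = "surviving R R' f f'" and ?S' = "surviving R' R f' f"
  assume "(u, v) \<in> parcs (two_bite n R R' f f')" "(v, w) \<in> parcs (two_bite n R R' f f')"
    "(w, u) \<in> parcs (two_bite n R R' f f')"
  then have e: "?S u v \<or> ?S' u v" "?S v w \<or> ?S' v w" "?S w u \<or> ?S' w u"
    by (auto simp: two_bite_def)
  have s: "?S x y \<Longrightarrow> ?S y x" "?S' x y \<Longrightarrow> ?S' y x" for x y
    using surviving_sym R R' by metis+
  have p: "?S x y \<Longrightarrow> ?S y z \<Longrightarrow> ?S' z x \<Longrightarrow> False" "?S' x y \<Longrightarrow> ?S' y z \<Longrightarrow> ?S z x \<Longrightarrow> False" for x y z
    using surviving_path_closes[of R R' f f' x y z] surviving_path_closes[of R' R f' f x y z] R R' s by metis+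
  have t: "?S u v \<Longrightarrow> ?S v w \<Longrightarrow> ?S w u \<Longrightarrow> False" "?S' u v \<Longrightarrow> ?S' v w \<Longrightarrow> ?S' w u \<Longrightarrow> False"
    using no_surviving_triangle[of R R' f f' u v w] no_surviving_triangle[of R' R f' f u v w] R R' by metis+
  show False using e p t by metis
qed

text \<open>Independence passes to subsets, so a larger independent set would contain one of size
  exactly \<open>k\<close>.\<close>

lemma independence_number_less:
  assumes "finite (pverts G)" "\<And>T. T \<subseteq> pverts G \<Longrightarrow> card T = k \<Longrightarrow> \<not> independent_set G T"
  shows "independence_number G < k"
proof -
  let ?I = "{S. independent_set G S}"
  have "?I \<subseteq> Pow (pverts G)" by (auto simp: independent_set_def)
  then have fin: "finite ?I" using assms(1) finite_subset by blast
  have ne: "{} \<in> ?I" by (simp add: independent_set_def)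
  have "card S < k" if S: "independent_set G S" for S
  proof (rule ccontr)
    assume "\<not> card S < k"
    then obtain T where T: "T \<subseteq> S" "card T = k" by (meson not_less obtain_subset_with_card_n)
    then have "independent_set G T" using S by (auto simp: independent_set_def)
    then show False using assms(2)[of T] T S by (auto simp: independent_set_def)
  qed
  then show ?thesis using fin ne unfolding independence_number_def by (subst Max_less_iff) auto
qed

subsection \<open>Spreading maps\<close>

lemma card_large_fibre_le:
  assumes "0 < m"
  shows "real (card {f\<in>{..<n} \<rightarrow>\<^sub>E {..<m}. \<exists>y\<in>{..<m}. 3/2 * (real n / m) \<le> real (card {u\<in>{..<n}. f u = y})})
    \<le> real m ^ n * (m * exp (- (real n / m / 25)))"
proof -
  have "real (card {f\<in>{..<n} \<rightarrow>\<^sub>E {..<m}. 3/2 * (real n / m) \<le> real (card {u\<in>{..<n}. f u = y})})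
      \<le> real m ^ n * exp (- (real n / m / 25))" if "y \<in> {..<m}" for y
  proof -
    have "real (card {f\<in>{..<n} \<rightarrow>\<^sub>E {..<m}. 3/2 * (real n / m) \<le> real (card {u\<in>{..<n}. f u = y})})
       \<le> real m ^ card {..<n} * exp ((3/2 - 1) * card {..<n} / m) * (3/2) powr (- (3/2 * (real n / m)))"
      by (rule card_PiE_tail) (use that in auto)
    also have "\<dots> = real m ^ n * (exp (1/2 * (real n / m)) * (3/2) powr (- (3/2 * (real n / m))))"
      by simp
    also have "\<dots> \<le> real m ^ n * exp (- (real n / m / 25))"
      by (intro mult_left_mono chernoff_three_halves) auto
    finally show ?thesis .
  qed
  then have "real (card {f\<in>{..<n} \<rightarrow>\<^sub>E {..<m}. \<exists>y\<in>{..<m}. 3/2 * (real n / m) \<le> real (card {u\<in>{..<n}. f u = y})})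
    \<le> (\<Sum>y\<in>{..<m}. real m ^ n * exp (- (real n / m / 25)))"
    by (intro card_Bex_le) auto
  then show ?thesis by (simp add: mult.left_commute)
qed

lemma card_PiE_image_subset:
  assumes "T \<subseteq> {..<n}" "W \<subseteq> {..<m}" "0 < m"
  shows "real (card {f\<in>{..<n} \<rightarrow>\<^sub>E {..<m}. f ` T \<subseteq> W}) = real m ^ n * (real (card W) / m) ^ card T"
proof -
  have fin: "finite T" using assms(1) finite_subset by blast
  have "{f\<in>{..<n} \<rightarrow>\<^sub>E {..<m}. f ` T \<subseteq> W} = (\<Pi>\<^sub>E u\<in>{..<n}. if u \<in> T then W else {..<m})"
  proof (intro set_eqI iffI)
    fix f assume "f \<in> {f\<in>{..<n} \<rightarrow>\<^sub>E {..<m}. f ` T \<subseteq> W}"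
    then show "f \<in> (\<Pi>\<^sub>E u\<in>{..<n}. if u \<in> T then W else {..<m})"
      by (auto simp: PiE_iff)
  next
    fix f assume f: "f \<in> (\<Pi>\<^sub>E u\<in>{..<n}. if u \<in> T then W else {..<m})"
    have mem: "f u \<in> (if u \<in> T then W else {..<m})" if "u < n" for u
      using PiE_mem[OF f, of u] that by simp
    have "f u < m" if "u < n" for u using mem[OF that] assms(2) by (auto split: if_splits)
    moreover have "f u \<in> W" if "u \<in> T" for u
    proof -
      have "u < n" using that assms(1) by auto
      then show ?thesis using mem[of u] that by simp
    qed
    ultimately show "f \<in> {f\<in>{..<n} \<rightarrow>\<^sub>E {..<m}. f ` T \<subseteq> W}"
      using f by (auto simp: PiE_iff)
  qed
  then have "card {f\<in>{..<n} \<rightarrow>\<^sub>E {..<m}. f ` T \<subseteq> W} = (\<Prod>u<n. if u \<in> T then card W else m)"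
    by (simp add: card_PiE if_distrib[of card] cong: if_cong)
  also have "\<dots> = card W ^ card T * m ^ card ({..<n} - T)"
  proof -
    have "{..<n} \<inter> {u. u \<in> T} = T" "{..<n} \<inter> - {u. u \<in> T} = {..<n} - T" using assms(1) by auto
    then show ?thesis by (simp add: prod.If_cases)
  qed
  finally have 1: "real (card {f\<in>{..<n} \<rightarrow>\<^sub>E {..<m}. f ` T \<subseteq> W}) = real (card W) ^ card T * real m ^ card ({..<n} - T)"
    by simp
  have "card T + card ({..<n} - T) = n"
    using card_mono[OF _ assms(1)] fin by (simp add: card_Diff_subset assms(1))
  then have "real m ^ n = real m ^ card T * real m ^ card ({..<n} - T)" by (simp flip: power_add)
  then show ?thesis unfolding 1 using assms(3) by (simp add: power_divide)
qed

text \<open>A small image lies in some set of exactly \<open>a\<close> blocks, which costs a single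
  binomial coefficient in the union bound.\<close>

lemma card_small_image_le:
  assumes "T \<subseteq> {..<n}" "0 < m" "a \<le> m"
  shows "real (card {f\<in>{..<n} \<rightarrow>\<^sub>E {..<m}. card (f ` T) < a})
    \<le> real m ^ n * ((m choose a) * (real a / m) ^ card T)"
proof -
  let ?W = "{W\<in>Pow {..<m}. card W = a}"
  have "{f\<in>{..<n} \<rightarrow>\<^sub>E {..<m}. card (f ` T) < a} \<subseteq> {f\<in>{..<n} \<rightarrow>\<^sub>E {..<m}. \<exists>W\<in>?W. f ` T \<subseteq> W}"
  proof (intro subsetI CollectI conjI)
    fix f assume f: "f \<in> {f\<in>{..<n} \<rightarrow>\<^sub>E {..<m}. card (f ` T) < a}"
    then show "f \<in> {..<n} \<rightarrow>\<^sub>E {..<m}" by blast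
    have "f ` T \<subseteq> {..<m}" using f assms(1) by (fastforce simp: PiE_iff)
    then obtain W where "f ` T \<subseteq> W" "W \<subseteq> {..<m}" "card W = a"
      using f assms(3) exists_subset_between[of "f ` T" a "{..<m}"] by auto
    then show "\<exists>W\<in>?W. f ` T \<subseteq> W" by blast
  qed
  then have "real (card {f\<in>{..<n} \<rightarrow>\<^sub>E {..<m}. card (f ` T) < a})
      \<le> real (card {f\<in>{..<n} \<rightarrow>\<^sub>E {..<m}. \<exists>W\<in>?W. f ` T \<subseteq> W})"
    using finite_lessThan_PiE[of "{..<n}" m] by (intro of_nat_mono card_mono) auto
  also have "\<dots> \<le> (\<Sum>W\<in>?W. real m ^ n * (real a / m) ^ card T)"
    by (rule card_Bex_le) (use assms card_PiE_image_subset[OF assms(1) _ assms(2)] in auto)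
  also have "\<dots> = real m ^ n * ((m choose a) * (real a / m) ^ card T)"
    using n_subsets[of "{..<m}" a] by simp
  finally show ?thesis .
qed

text \<open>Pairs of maps are counted in a product space, so the bound for one map squeezing a given
  \<open>k\<close>-set enters squared. For the parameters used later, a single factor of this bound
  would not outweigh the number of \<open>k\<close>-sets.\<close>

lemma exists_spread_maps:
  assumes "0 < m" "a \<le> m"
    and small: "2 * (m * exp (- (real n / m / 25))) + (n choose k) * ((m choose a) * (real a / m) ^ k)\<^sup>2 < 1"
  obtains f f' :: "nat \<Rightarrow> nat" where
    "f ` {..<n} \<subseteq> {..<m}" "f' ` {..<n} \<subseteq> {..<m}"
    "\<And>y. real (card {u\<in>{..<n}. f u = y}) \<le> 3/2 * (real n / m)"
    "\<And>y. real (card {u\<in>{..<n}. f' u = y}) \<le> 3/2 * (real n / m)"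
    "\<And>T. T \<subseteq> {..<n} \<Longrightarrow> card T = k \<Longrightarrow> a \<le> card (f ` T) \<or> a \<le> card (f' ` T)"
proof -
  let ?F = "{..<n} \<rightarrow>\<^sub>E {..<m}"
  let ?L = "{f\<in>?F. \<exists>y\<in>{..<m}. 3/2 * (real n / m) \<le> real (card {u\<in>{..<n}. f u = y})}"
  let ?S = "\<lambda>T. {f\<in>?F. card (f ` T) < a}"
  let ?I = "{T\<in>Pow {..<n}. card T = k}"
  let ?Bad = "?L \<times> ?F \<union> ?F \<times> ?L \<union> (\<Union>T\<in>?I. ?S T \<times> ?S T)"
  have finF: "finite ?F" by (rule finite_lessThan_PiE) simp
  have cF: "card ?F = m ^ n" by (simp add: card_lessThan_PiE)
  have "real (card ?Bad) \<le> real (card (?L \<times> ?F) + card (?F \<times> ?L) + card (\<Union>T\<in>?I. ?S T \<times> ?S T))"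
    by (intro of_nat_mono) (meson card_Un_le add_le_mono order_trans order_refl)
  also have "\<dots> = 2 * (real (card ?L) * real m ^ n) + real (card (\<Union>T\<in>?I. ?S T \<times> ?S T))"
    by (simp add: card_cartesian_product cF)
  also have "\<dots> \<le> 2 * (real m ^ n * (m * exp (- (real n / m / 25))) * real m ^ n)
      + (n choose k) * (real m ^ n * ((m choose a) * (real a / m) ^ k))\<^sup>2"
  proof (intro add_mono mult_left_mono mult_right_mono card_large_fibre_le)
    show "real (card (\<Union>T\<in>?I. ?S T \<times> ?S T)) \<le> (n choose k) * (real m ^ n * ((m choose a) * (real a / m) ^ k))\<^sup>2"
    proof (rule card_UN_le_const)
      fix T assume T: "T \<in> ?I"
      then have "real (card (?S T)) \<le> real m ^ n * ((m choose a) * (real a / m) ^ k)"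
        using card_small_image_le[of T n m a] assms by auto
      then show "real (card (?S T \<times> ?S T)) \<le> (real m ^ n * ((m choose a) * (real a / m) ^ k))\<^sup>2"
        unfolding card_cartesian_product of_nat_mult power2_eq_square by (intro mult_mono) auto
    qed (use n_subsets[of "{..<n}" k] in auto)
  qed (use assms in auto)
  also have "\<dots> = (real m ^ n)\<^sup>2 * (2 * (m * exp (- (real n / m / 25))) + (n choose k) * ((m choose a) * (real a / m) ^ k)\<^sup>2)"
    by (simp add: power_mult_distrib power2_eq_square algebra_simps)
  also have "\<dots> < (real m ^ n)\<^sup>2 * 1"
    using small assms(1) by (intro mult_strict_left_mono) auto
  also have "\<dots> = real (card (?F \<times> ?F))" by (simp add: card_cartesian_product cF power2_eq_square)
  finally have less: "card ?Bad < card (?F \<times> ?F)" by (simp only: of_nat_less_iff)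
  have "finite ?L" "finite (?S T)" for T using finF by simp_all
  then have finBad: "finite ?Bad" using finF by simp
  have "\<not> ?F \<times> ?F \<subseteq> ?Bad"
  proof
    assume "?F \<times> ?F \<subseteq> ?Bad"
    then have "card (?F \<times> ?F) \<le> card ?Bad" by (rule card_mono[OF finBad])
    then show False using less by linarith
  qed
  then obtain p where p: "p \<in> ?F \<times> ?F" "p \<notin> ?Bad" by blast
  obtain f f' where eq: "p = (f, f')" by (cases p)
  have "f \<in> ?F" "f' \<in> ?F" using p(1) unfolding eq by (simp_all only: mem_Sigma_iff)
  note f = this p(2)[unfolded eq]
  have fibre: "real (card {u\<in>{..<n}. g u = y}) \<le> 3/2 * (real n / m)" if "g \<in> ?F" "g \<notin> ?L" for g y
  proof (cases "y < m")
    case True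
    then show ?thesis using that by force
  next
    case False
    then have "{u\<in>{..<n}. g u = y} = {}" using that(1) by (auto simp: PiE_iff)
    then show ?thesis by (simp only: card.empty) simp
  qed
  have L: "f \<notin> ?L" "f' \<notin> ?L" using f by blast+
  show ?thesis
  proof (rule that)
    show "f ` {..<n} \<subseteq> {..<m}" "f' ` {..<n} \<subseteq> {..<m}" using f by (auto simp: PiE_iff)
    show "real (card {u\<in>{..<n}. f u = y}) \<le> 3/2 * (real n / m)" for y by (rule fibre[OF f(1) L(1)])
    show "real (card {u\<in>{..<n}. f' u = y}) \<le> 3/2 * (real n / m)" for y by (rule fibre[OF f(2) L(2)])
    show "a \<le> card (f ` T) \<or> a \<le> card (f' ` T)" if T: "T \<subseteq> {..<n}" "card T = k" for T
    proof (rule ccontr)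
      assume "\<not> ?thesis"
      then have "(f, f') \<in> ?S T \<times> ?S T" using f(1,2) by auto
      then show False using f(3) T by blast
    qed
  qed
qed

section \<open>Existence of a good pair of block graphs\<close>

definition quasirandom :: "nat \<Rightarrow> real \<Rightarrow> nat \<Rightarrow> nat \<Rightarrow> real \<Rightarrow> real \<Rightarrow> real \<Rightarrow> nat \<Rightarrow> (nat \<Rightarrow> nat \<Rightarrow> bool) \<Rightarrow> bool" where
  "quasirandom m \<Delta> D a x K b N R \<longleftrightarrow>
     max_degree_le m \<Delta> R \<and> codegree_le m D R \<and> rich_sum_le m a x K R \<and> pair_rich_le m b N R"

lemma card_not_quasirandom_le:
  fixes \<kappa> \<kappa>' x K b :: real
  assumes "0 < q" "0 < m" "0 < N" "1 \<le> \<kappa>" "1 \<le> \<kappa>'"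
    and "8 * \<kappa> * a / q \<le> x * ln \<kappa>" "8 * ln m \<le> x * ln \<kappa>" "4 * (ln m + 1) \<le> K * ln \<kappa>"
    and "\<kappa>' * b \<le> q" "b * ln m \<le> N" "m * exp 4 \<le> N * \<kappa>'\<^sup>2"
  shows "real (card {g\<in>pairs m \<rightarrow>\<^sub>E {..<q}. \<not> quasirandom m (3/2 * m / q) D a x K b N (adj m g)})
    \<le> real q ^ card (pairs m) * (m * exp (- (real m / (25 * real q)))
       + real m ^ (D + 3) * (exp 1 / real q) ^ (2 * (D + 1)) + exp (2 - real a) + exp (1 - real N))"
proof -
  let ?\<Omega> = "pairs m \<rightarrow>\<^sub>E {..<q}"
  let ?A = "{g\<in>?\<Omega>. \<not> max_degree_le m (3/2 * m / q) (adj m g)}" and ?B = "{g\<in>?\<Omega>. \<not> codegree_le m D (adj m g)}"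
  let ?C = "{g\<in>?\<Omega>. \<not> rich_sum_le m a x K (adj m g)}" and ?E = "{g\<in>?\<Omega>. \<not> pair_rich_le m b N (adj m g)}"
  have "{g\<in>?\<Omega>. \<not> quasirandom m (3/2 * m / q) D a x K b N (adj m g)} = ?A \<union> ?B \<union> ?C \<union> ?E"
    by (auto simp: quasirandom_def)
  then have "card {g\<in>?\<Omega>. \<not> quasirandom m (3/2 * m / q) D a x K b N (adj m g)} \<le> card ?A + card ?B + card ?C + card ?E"
    by (simp only:) (meson card_Un_le add_le_mono order_trans order_refl)
  then have "real (card {g\<in>?\<Omega>. \<not> quasirandom m (3/2 * m / q) D a x K b N (adj m g)})
      \<le> real (card ?A) + real (card ?B) + real (card ?C) + real (card ?E)"
    by (simp flip: of_nat_add)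
  also have "\<dots> \<le> real m * (real q ^ card (pairs m) * exp (- (real m / (25 * real q))))
      + real m ^ (D + 3) * (real q ^ card (pairs m) * (exp 1 / real q) ^ (2 * (D + 1)))
      + real q ^ card (pairs m) * exp (2 - real a) + real q ^ card (pairs m) * exp (1 - real N)"
    by (intro add_mono card_not_max_degree_le card_not_codegree_le card_not_rich_sum_le[of q m \<kappa> a x K] card_not_pair_rich_le[of q m \<kappa>' N b] assms)
  finally show ?thesis by (simp add: algebra_simps)
qed

text \<open>Union bound over the \<open>a\<close>-sets on which \<open>f\<close> is injective.
  \<open>good\<close> is part of the counted event because only good \<open>g\<close> are known to
  close few pairs of their own.\<close>

lemma card_no_surviving_transversal_le:
  fixes c c' U :: real
  assumes "1 < q" "f ` {..<n} \<subseteq> {..<m}"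
    and c: "\<And>g T. good g \<Longrightarrow> T \<subseteq> {..<n} \<Longrightarrow> card T = a \<Longrightarrow> inj_on f T \<Longrightarrow>
      real (card (common_pairs (adj m g) f T)) \<le> c"
    and c': "\<And>T. T \<subseteq> {..<n} \<Longrightarrow> card T = a \<Longrightarrow> real (card (common_pairs R' f' T)) \<le> c'"
    and U: "2 * U \<le> real a * real a - a - c - c'"
  shows "real (card {g\<in>pairs m \<rightarrow>\<^sub>E {..<q}. good g \<and>
      (\<exists>T\<in>{T\<in>Pow {..<n}. card T = a}. inj_on f T \<and> (\<forall>u\<in>T. \<forall>v\<in>T. \<not> surviving (adj m g) R' f f' u v))})
    \<le> real q ^ card (pairs m) * ((n choose a) * exp (- U / q))"
proof -
  let ?\<Omega> = "pairs m \<rightarrow>\<^sub>E {..<q}"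
  let ?I = "{T\<in>Pow {..<n}. card T = a}"
  let ?Q = "\<lambda>T g. good g \<and> inj_on f T \<and> (\<forall>u\<in>T. \<forall>v\<in>T. \<not> surviving (adj m g) R' f f' u v)"
  have "real (card {g\<in>?\<Omega>. \<exists>T\<in>?I. ?Q T g}) \<le> (\<Sum>T\<in>?I. real q ^ card (pairs m) * exp (- U / q))"
  proof (rule card_Bex_le)
    fix T assume T: "T \<in> ?I"
    then have finT: "finite T" using finite_subset by blast
    show "real (card {g\<in>?\<Omega>. ?Q T g}) \<le> real q ^ card (pairs m) * exp (- U / q)"
    proof (cases "inj_on f T")
      case True
      have "{g\<in>?\<Omega>. ?Q T g} \<subseteq> {g\<in>?\<Omega>. real (card (common_pairs (adj m g) f T)) \<le> c
          \<and> (\<forall>u\<in>T. \<forall>v\<in>T. \<not> surviving (adj m g) R' f f' u v)}"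
        using c T by auto
      then have "real (card {g\<in>?\<Omega>. ?Q T g}) \<le> real (card {g\<in>?\<Omega>. real (card (common_pairs (adj m g) f T)) \<le> c
          \<and> (\<forall>u\<in>T. \<forall>v\<in>T. \<not> surviving (adj m g) R' f f' u v)})"
        using finite_lessThan_PiE[OF finite_pairs] by (intro of_nat_mono card_mono) auto
      also have "\<dots> \<le> real q ^ card (pairs m) * exp (- U / q)"
        by (rule card_no_surviving_le[where a = a and c' = c']) (use assms(1,2) c' T finT U True in auto)
      finally show ?thesis .
    next
      case False
      then have "{g\<in>?\<Omega>. ?Q T g} = {}" by auto
      then show ?thesis by (simp only: card.empty) simp
    qed
  qed auto
  also have "\<dots> = real q ^ card (pairs m) * ((n choose a) * exp (- U / q))"
    using n_subsets[of "{..<n}" a] by simp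
  also have "{g\<in>?\<Omega>. \<exists>T\<in>?I. ?Q T g} = {g\<in>?\<Omega>. good g \<and>
      (\<exists>T\<in>?I. inj_on f T \<and> (\<forall>u\<in>T. \<forall>v\<in>T. \<not> surviving (adj m g) R' f f' u v))}"
    by blast
  finally show ?thesis .
qed

text \<open>Four failures have proportion at most 1/8 each: one of the two block graphs is not
  quasirandom, or for one of the two maps some transversal has no surviving pair. So at least half
  of the pairs of block graphs work. All numerical demands stay hypotheses here.\<close>

lemma exists_two_bite_graph:
  fixes n m q a k D N :: nat and x K b W h \<kappa> \<kappa>' U E s \<Delta> :: real
  defines "s \<equiv> 3/2 * (real n / m)" and "\<Delta> \<equiv> 3/2 * m / q"
  assumes pos: "1 < q" "0 < m" "a \<le> m" "0 < N" "1 \<le> \<kappa>" "1 \<le> \<kappa>'" "0 \<le> x" "0 \<le> K" "0 < W" "0 < h" "1 \<le> s" "0 \<le> b"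
    and maps: "2 * (m * exp (- (real n / m / 25))) + (n choose k) * ((m choose a) * (real a / m) ^ k)\<^sup>2 < 1"
    and \<kappa>: "8 * \<kappa> * a / q \<le> x * ln \<kappa>" "8 * ln m \<le> x * ln \<kappa>" "4 * (ln m + 1) \<le> K * ln \<kappa>"
    and \<kappa>': "\<kappa>' * b \<le> q" "b * ln m \<le> N" "m * exp 4 \<le> N * \<kappa>'\<^sup>2"
    and fail: "m * exp (- (real m / (25 * real q))) + real m ^ (D + 3) * (exp 1 / real q) ^ (2 * (D + 1))
       + exp (2 - real a) + exp (1 - real N) \<le> 1/8"
    and h: "x * s \<le> h" and W: "a \<le> b * W"
    and E: "s * a + s * \<Delta> * ((s * K * a / h)\<^sup>2 * (s * D)) + h * (s * K * a)
        + 2 * (a * (\<Delta> * (W * x))) + (N + b) * (s * x)\<^sup>2 \<le> E"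
    and U: "2 * U \<le> real a * real a - a - (\<Delta> * a + E) - (s * \<Delta> * a + E)"
    and union: "(n choose a) * exp (- U / q) \<le> 1/8"
  shows "\<exists>G :: nat pair_pre_digraph. pair_graph G \<and> card (pverts G) = n \<and> triangle_free G \<and> independence_number G < k"
proof -
  obtain f f' :: "nat \<Rightarrow> nat" where f: "f ` {..<n} \<subseteq> {..<m}" "f' ` {..<n} \<subseteq> {..<m}"
    and fibre: "\<And>y. real (card {u\<in>{..<n}. f u = y}) \<le> s" "\<And>y. real (card {u\<in>{..<n}. f' u = y}) \<le> s"
    and spread: "\<And>T. T \<subseteq> {..<n} \<Longrightarrow> card T = k \<Longrightarrow> a \<le> card (f ` T) \<or> a \<le> card (f' ` T)"
    using exists_spread_maps[OF pos(2,3) maps] unfolding s_def by blast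
  let ?\<Omega> = "pairs m \<rightarrow>\<^sub>E {..<q}"
  let ?I = "{T\<in>Pow {..<n}. card T = a}"
  define M where "M = real q ^ card (pairs m)"
  define good where "good g \<longleftrightarrow> quasirandom m \<Delta> D a x K b N (adj m g)" for g
  define S where "S F F' g' = {g\<in>?\<Omega>. good g \<and> (\<exists>T\<in>?I. inj_on F T \<and>
      (\<forall>u\<in>T. \<forall>v\<in>T. \<not> surviving (adj m g) (adj m g') F F' u v))}" for F F' :: "nat \<Rightarrow> nat" and g'
  define Bad where "Bad = {g\<in>?\<Omega>. \<not> good g}"
  have fin: "finite ?\<Omega>" by (rule finite_lessThan_PiE[OF finite_pairs])
  have M: "real (card ?\<Omega>) = M" "0 < M" using pos by (simp_all add: M_def card_lessThan_PiE finite_pairs)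
  have \<Delta>0: "0 \<le> \<Delta>" by (simp add: \<Delta>_def)
  \<comment> \<open>Used with \<open>t = 1\<close> where the map is injective, so that the main term
    is only \<open>\<Delta> * a\<close>, and with \<open>t = s\<close> for the other map. The error
    terms grow with \<open>t\<close>, so \<open>E\<close> is estimated once, at
    \<open>s\<close>.\<close>
  have common: "real (card (common_pairs (adj m g) F T)) \<le> t * \<Delta> * a + E"
    if "good g" "F ` {..<n} \<subseteq> {..<m}" "T \<subseteq> {..<n}" "card T = a" "1 \<le> t" "t \<le> s"
      "\<And>y. real (card {u\<in>T. F u = y}) \<le> t" for g F T t
  proof -
    have xt: "x * t \<le> h" using mult_left_mono[OF that(6) pos(7)] h by linarith
    have "real (card (common_pairs (adj m g) F T)) \<le> t * \<Delta> * a + (t * a + t * \<Delta> * ((t * K * a / h)\<^sup>2 * (t * D)) + h * (t * K * a)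
        + 2 * (a * (\<Delta> * (W * x))) + (N + b) * (t * x)\<^sup>2)"
    proof (rule card_common_pairs_le)
      show "finite T" using that(3) finite_subset by blast
      show "adj m g x y \<Longrightarrow> adj m g y x" for x y using adj_sym by blast
      show "adj m g x y \<Longrightarrow> x < m \<and> y < m" for x y by (rule adj_less)
    qed (use that pos \<Delta>0 xt W in \<open>auto simp: good_def quasirandom_def\<close>)
    also have "\<dots> \<le> t * \<Delta> * a + (s * a + s * \<Delta> * ((s * K * a / h)\<^sup>2 * (s * D)) + h * (s * K * a)
        + 2 * (a * (\<Delta> * (W * x))) + (N + b) * (s * x)\<^sup>2)"
      using that(5,6) pos \<Delta>0
      by (intro add_left_mono add_mono mult_mono power_mono divide_right_mono order_refl) (auto intro!: mult_nonneg_nonneg divide_nonneg_nonneg)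
    finally show ?thesis using E by linarith
  qed
  have fibre_T: "real (card {u\<in>T. F u = y}) \<le> s"
    if "\<And>y. real (card {u\<in>{..<n}. F u = y}) \<le> s" "T \<subseteq> {..<n}" for F :: "nat \<Rightarrow> nat" and T y
  proof -
    have "card {u\<in>T. F u = y} \<le> card {u\<in>{..<n}. F u = y}" using that(2) by (intro card_mono) auto
    then show ?thesis using that(1)[of y] by linarith
  qed
  have fibre_inj: "real (card {u\<in>T. F u = y}) \<le> 1" if "inj_on F T" for F :: "nat \<Rightarrow> nat" and T y
  proof -
    have "card {u\<in>T. F u = y} \<le> 1"
    proof (cases "finite {u\<in>T. F u = y}")
      case True
      then show ?thesis using that by (auto simp: card_le_Suc0_iff_eq inj_on_def)
    qed (simp add: card.infinite)
    then show ?thesis by simp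
  qed
  have cardS: "real (card (S F F' g')) \<le> M * (1/8)"
    if "good g'" "F ` {..<n} \<subseteq> {..<m}" "F' ` {..<n} \<subseteq> {..<m}" "\<And>y. real (card {u\<in>{..<n}. F' u = y}) \<le> s" for F F' g'
  proof -
    have "real (card (S F F' g')) \<le> M * ((n choose a) * exp (- U / q))"
      unfolding S_def M_def
    proof (rule card_no_surviving_transversal_le[where c = "1 * \<Delta> * a + E" and c' = "s * \<Delta> * a + E"])
      show "real (card (common_pairs (adj m g) F T)) \<le> 1 * \<Delta> * a + E"
        if "good g" "T \<subseteq> {..<n}" "card T = a" "inj_on F T" for g T
        by (rule common) (use that \<open>F ` {..<n} \<subseteq> {..<m}\<close> pos fibre_inj in auto)
      show "real (card (common_pairs (adj m g') F' T)) \<le> s * \<Delta> * a + E" if "T \<subseteq> {..<n}" "card T = a" for T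
        by (rule common[OF \<open>good g'\<close> \<open>F' ` {..<n} \<subseteq> {..<m}\<close> that pos(11) order_refl])
          (rule fibre_T[OF \<open>\<And>y. real (card {u\<in>{..<n}. F' u = y}) \<le> s\<close> that(1)])
    qed (use pos that U in auto)
    also have "\<dots> \<le> M * (1/8)" using union M by (intro mult_left_mono) auto
    finally show ?thesis .
  qed
  have cardBad: "real (card Bad) \<le> M * (1/8)"
  proof -
    have "real (card Bad) \<le> M * (m * exp (- (real m / (25 * real q)))
       + real m ^ (D + 3) * (exp 1 / real q) ^ (2 * (D + 1)) + exp (2 - real a) + exp (1 - real N))"
      unfolding Bad_def M_def good_def \<Delta>_def
      by (rule card_not_quasirandom_le[where \<kappa> = \<kappa> and \<kappa>' = \<kappa>']) (use pos \<kappa> \<kappa>' in auto)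
    also have "\<dots> \<le> M * (1/8)" using fail M by (intro mult_left_mono) auto
    finally show ?thesis .
  qed
  let ?G = "{g\<in>?\<Omega>. good g}"
  \<comment> \<open>The graph \<open>g'\<close> is fixed first and the count runs over
    \<open>g\<close>; this uses the independence of the two block graphs. As \<open>g'\<close>
    stands first in these pairs, one of the two sets is swapped below.\<close>
  define X where "X F F' = (SIGMA g':?G. S F F' g')" for F F'
  have finS: "finite (S F F' g')" for F F' g' using fin by (simp add: S_def)
  have finX: "finite (X F F')" for F F' unfolding X_def using fin finS by (intro finite_SigmaI) auto
  have cardX: "real (card (X F F')) \<le> M * (M * (1/8))"
    if "F ` {..<n} \<subseteq> {..<m}" "F' ` {..<n} \<subseteq> {..<m}" "\<And>y. real (card {u\<in>{..<n}. F' u = y}) \<le> s" for F F'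
  proof -
    have "real (card (X F F')) = (\<Sum>g'\<in>?G. real (card (S F F' g')))"
      unfolding X_def using fin finS by (subst card_SigmaI) auto
    also have "\<dots> \<le> (\<Sum>g'\<in>?G. M * (1/8))" using that by (intro sum_mono cardS) auto
    also have "\<dots> = real (card ?G) * (M * (1/8))" by simp
    also have "\<dots> \<le> M * (M * (1/8))"
      using M fin by (intro mult_right_mono) (auto simp flip: M(1) intro!: card_mono)
    finally show ?thesis .
  qed
  let ?B = "Bad \<times> ?\<Omega> \<union> ?\<Omega> \<times> Bad \<union> prod.swap ` X f f' \<union> X f' f"
  have finBad: "finite Bad" using fin by (simp add: Bad_def)
  have finB: "finite ?B" using fin finBad finX by simp
  have "card ?B \<le> card (Bad \<times> ?\<Omega>) + card (?\<Omega> \<times> Bad) + card (prod.swap ` X f f') + card (X f' f)"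
    by (meson card_Un_le add_le_mono order_trans order_refl)
  also have "card (prod.swap ` X f f') = card (X f f')" by (rule card_image) auto
  finally have "card ?B \<le> card Bad * card ?\<Omega> + card ?\<Omega> * card Bad + card (X f f') + card (X f' f)"
    by (simp only: card_cartesian_product)
  then have "real (card ?B) \<le> real (card Bad * card ?\<Omega> + card ?\<Omega> * card Bad + card (X f f') + card (X f' f))"
    by (rule of_nat_mono)
  then have "real (card ?B) \<le> real (card Bad) * M + M * real (card Bad) + real (card (X f f')) + real (card (X f' f))"
    by (simp only: of_nat_add of_nat_mult M(1))
  also have "\<dots> \<le> M * (1/8) * M + M * (M * (1/8)) + M * (M * (1/8)) + M * (M * (1/8))"
    using M by (intro add_mono mult_right_mono mult_left_mono cardBad cardX f fibre) auto
  also have "\<dots> = M * M / 2" by (simp add: field_simps)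
  also have "\<dots> < M * M" using M by simp
  also have "\<dots> = real (card (?\<Omega> \<times> ?\<Omega>))" by (simp only: card_cartesian_product of_nat_mult M(1))
  finally have less: "card ?B < card (?\<Omega> \<times> ?\<Omega>)" by (simp only: of_nat_less_iff)
  have "\<not> ?\<Omega> \<times> ?\<Omega> \<subseteq> ?B"
  proof
    assume "?\<Omega> \<times> ?\<Omega> \<subseteq> ?B"
    then have "card (?\<Omega> \<times> ?\<Omega>) \<le> card ?B" by (rule card_mono[OF finB])
    then show False using less by linarith
  qed
  then obtain p where p: "p \<in> ?\<Omega> \<times> ?\<Omega>" "p \<notin> ?B" by blast
  obtain g g' where eq: "p = (g, g')" by (cases p)
  have g: "g \<in> ?\<Omega>" "g' \<in> ?\<Omega>" using p(1) unfolding eq by (simp_all only: mem_Sigma_iff)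
  have nB: "(g, g') \<notin> Bad \<times> ?\<Omega>" "(g, g') \<notin> ?\<Omega> \<times> Bad" "(g, g') \<notin> prod.swap ` X f f'" "(g, g') \<notin> X f' f"
    using p(2) unfolding eq by blast+
  have gd: "good g" "good g'" using nB(1,2) g by (auto simp: Bad_def)
  have "g \<notin> S f f' g'"
  proof
    assume "g \<in> S f f' g'"
    then have "(g', g) \<in> X f f'" using g gd by (simp add: X_def)
    then have "prod.swap (g', g) \<in> prod.swap ` X f f'" by (rule imageI)
    then show False using nB(3) by simp
  qed
  moreover have "g' \<notin> S f' f g" using nB(4) g gd by (simp add: X_def)
  ultimately have nS: "g \<notin> S f f' g'" "g' \<notin> S f' f g" .
  let ?R = "adj m g" and ?R' = "adj m g'"
  let ?H = "two_bite n ?R ?R' f f'"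
  have sym: "adj m g x y \<Longrightarrow> adj m g y x" for g x y using adj_sym by blast
  have verts: "pverts ?H = {..<n}" by (simp add: two_bite_def)
  have transversal: "\<exists>T'\<in>?I. T' \<subseteq> T \<and> inj_on F T'" if T: "T \<subseteq> {..<n}" "a \<le> card (F ` T)" for F :: "nat \<Rightarrow> nat" and T
  proof -
    obtain Y where Y: "Y \<subseteq> F ` T" "card Y = a" using obtain_subset_with_card_n[OF T(2)] by blast
    then obtain T' where "T' \<subseteq> T" "inj_on F T'" "Y = F ` T'" by (auto simp: subset_image_inj)
    then show ?thesis using Y(2) T(1) by (auto simp: card_image)
  qed
  have "independence_number ?H < k"
  proof (rule independence_number_less)
    fix T assume T: "T \<subseteq> pverts ?H" "card T = k"
    then have Tn: "T \<subseteq> {..<n}" by (simp add: verts)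
    show "\<not> independent_set ?H T"
    proof
      assume "independent_set ?H T"
      then have ind: "\<not> surviving ?R ?R' f f' u v" "\<not> surviving ?R' ?R f' f u v" if "u \<in> T" "v \<in> T" for u v
        using that T(1) by (auto simp: independent_set_def two_bite_def)
      consider "a \<le> card (f ` T)" | "a \<le> card (f' ` T)" using spread[OF Tn T(2)] by blast
      then show False
      proof cases
        case 1
        then obtain T' where T': "T' \<in> ?I" "T' \<subseteq> T" "inj_on f T'" using transversal[OF Tn 1] by (elim bexE conjE)
        have "\<forall>u\<in>T'. \<forall>v\<in>T'. \<not> surviving ?R ?R' f f' u v" using T'(2) ind(1) by blast
        then have "g \<in> S f f' g'"
          unfolding S_def mem_Collect_eq using T'(1,3) g(1) gd(1) by (intro conjI bexI[of _ T'])
        then show False using nS by blast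
      next
        case 2
        then obtain T' where T': "T' \<in> ?I" "T' \<subseteq> T" "inj_on f' T'" using transversal[OF Tn 2] by (elim bexE conjE)
        have "\<forall>u\<in>T'. \<forall>v\<in>T'. \<not> surviving ?R' ?R f' f u v" using T'(2) ind(2) by blast
        then have "g' \<in> S f' f g"
          unfolding S_def mem_Collect_eq using T'(1,3) g(2) gd(2) by (intro conjI bexI[of _ T'])
        then show False using nS by blast
      qed
    qed
  qed (simp add: verts)
  moreover have "pair_graph ?H" by (rule pair_graph_two_bite) (auto intro: sym simp: adj_irrefl)
  moreover have "triangle_free ?H" by (rule triangle_free_two_bite) (auto intro: sym simp: adj_irrefl)
  moreover have "card (pverts ?H) = n" by (simp add: verts)
  ultimately show ?thesis by blast
qed

subsection \<open>Choice of the parameters\<close>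

text \<open>For \<open>j\<close> at least \<open>4 * sqrt (n ln n)\<close> the quotient
  \<open>exp 1 * n / j\<close> drops below \<open>sqrt n\<close>, so each element of the set costs
  only half a logarithm.\<close>

lemma binomial_le_exp_ln:
  assumes "0 < j" "real j \<le> x" "x = real n" "0 < x" "exp 1 * x / j \<le> x powr (1/2)"
  shows "real (n choose j) \<le> exp (j * (ln x / 2))"
proof -
  have "real (n choose j) \<le> (exp 1 * real n / real j) ^ j"
    by (rule binomial_le_exp_power) (use assms in auto)
  also have "\<dots> \<le> (x powr (1/2)) ^ j" using assms by (intro power_mono) auto
  also have "x powr (1/2) = exp (ln x / 2)" using assms by (simp add: powr_def)
  also have "exp (ln x / 2) ^ j = exp (j * (ln x / 2))" by (rule exp_of_nat_mult[symmetric])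
  finally show ?thesis .
qed

text \<open>Of the \<open>k\<close> factors \<open>a / m\<close>, \<open>a\<close> cancel against
  the binomial coefficient up to \<open>exp a\<close>, where \<open>a \<le> k / 2\<close>. The other
  \<open>k - a\<close>, at least \<open>59/100 * k\<close>, gain \<open>44/100 * L\<close> each;
  \<open>2596/10000\<close> is the product of these fractions.\<close>

lemma small_image_bound:
  fixes L :: real
  assumes "0 < a" "a \<le> m" "a \<le> k" "0 \<le> L" "100 * real a \<le> 41 * k" "real a / m \<le> exp (- (44/100 * L))"
  shows "(m choose a) * (real a / m) ^ k \<le> exp (k / 2 - 2596/10000 * L * k)"
proof -
  have "(m choose a) * (real a / m) ^ k \<le> (exp 1 * real m / real a) ^ a * (real a / m) ^ k"
    using assms by (intro mult_right_mono binomial_le_exp_power) auto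
  also have "\<dots> = (exp 1 * real m / real a) ^ a * ((real a / m) ^ a * (real a / m) ^ (k - a))"
    using assms by (simp flip: power_add)
  also have "\<dots> = exp 1 ^ a * (real a / m) ^ (k - a)"
    using assms by (simp flip: power_mult_distrib mult.assoc)
  also have "\<dots> \<le> exp 1 ^ a * exp (- (44/100 * L)) ^ (k - a)"
    using assms by (intro mult_left_mono power_mono) auto
  also have "\<dots> = exp (real a * 1) * exp (real (k - a) * - (44/100 * L))"
    by (simp only: exp_of_nat_mult)
  also have "\<dots> = exp (real a - 44/100 * L * (real k - real a))"
    using assms by (simp add: of_nat_diff algebra_simps flip: exp_add)
  also have "\<dots> \<le> exp (k / 2 - 2596/10000 * L * k)"
  proof -
    have "44/100 * L * (59/100 * k) \<le> 44/100 * L * (real k - real a)"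
      using assms by (intro mult_left_mono) auto
    then show ?thesis using assms(5) by simp
  qed
  finally show ?thesis .
qed

text \<open>The parameters are \<open>m = n powr 0.95\<close> blocks and \<open>q = sqrt (n / ln n)\<close>. At least
  \<open>1 - 9/16\<close> of the pairs of \<open>T\<close> stay open up to lower order terms, and \<open>15/100 * a\<^sup>2\<close> of them suffice: the exponent
  \<open>0.15 * a\<^sup>2 / q\<close> is at least \<open>0.585 * a * ln n\<close>, whereas there are only about
  \<open>exp (0.5 * a * ln n)\<close> sets \<open>T\<close>.\<close>

lemma exists_two_bite_graph_of_numerics:
  fixes n :: nat and x L A Q M :: real
  defines "x \<equiv> real n" and "L \<equiv> ln x" and "A \<equiv> sqrt (x * L)" and "Q \<equiv> sqrt (x / L)"
    and "M \<equiv> x powr (19/20)"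
  assumes large: "40 \<le> x" "105 \<le> L" "25 \<le> A" "2 \<le> Q" "1 \<le> M"
    and c1: "2 * ((2 * M) * exp (- (x powr (1/20) / 50))) \<le> 1/4"
    and c2: "41/10 * A \<le> x powr (- (44/100)) * M"
    and c3: "10 * A + 1 \<le> x"
    and c4: "M + 1 \<le> x"
    and c5: "(2 * M) * exp (- (M / (50 * Q))) \<le> 1/32"
    and c6: "(2 * M) ^ 62 * (exp 1 / Q) ^ 120 \<le> 1/32"
    and c7: "exp (2 - 4 * A) \<le> 1/32"
    and c8: "exp (1 - x powr (88/100)) \<le> 1/32"
    and c9: "8 * x powr (1/400) * (4 * A + 1) / Q \<le> x powr (1/200) * (L / 400)"
    and c10: "8 * L \<le> x powr (1/200) * (L / 400)"
    and c11: "x powr (38/1000) * ((4 * A + 1) / x powr (1/25)) \<le> Q"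
    and c12: "((4 * A + 1) / x powr (1/25)) * L \<le> x powr (88/100)"
    and c13: "(2 * M) * exp 4 \<le> x powr (88/100) * (x powr (38/1000))\<^sup>2"
    and c14: "x powr (1/200) * (3/2 * x powr (1/20)) \<le> x powr (2/5)"
    and c15: "2 * M \<le> x"
    and c16: "3 * M / Q \<le> 1/50 * (4 * A)"
    and c17: "39/10 * L * (Q + 1) \<le> 4 * A"
    and c18: "exp 1 * x / (4 * A) \<le> x powr (1/2)"
    and c19: "3/2 * x powr (1/20) * (4 * A + 1)
     + 3/2 * x powr (1/20) * (3 * M / Q) *
         ((3/2 * x powr (1/20) * 2000 * (4 * A + 1) / x powr (2/5))\<^sup>2 * (3/2 * x powr (1/20) * 59))
     + x powr (2/5) * (3/2 * x powr (1/20) * 2000 * (4 * A + 1))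
     + 2 * ((4 * A + 1) * (3 * M / Q * (x powr (1/25) * x powr (1/200))))
     + (x powr (88/100) + 1 + (4 * A + 1) / x powr (1/25)) * (3/2 * x powr (1/20) * x powr (1/200))\<^sup>2
     \<le> 32/100 * (x * L)"
  shows "\<exists>G :: nat pair_pre_digraph. pair_graph G \<and> card (pverts G) = n \<and> triangle_free G
    \<and> independence_number G < nat \<lfloor>10 * A\<rfloor> + 1"
proof -
  \<comment> \<open>With \<open>k\<close> one more than the floor, an independence number below
    \<open>k\<close> is at most \<open>10 * A\<close>, without any error term.\<close>
  define m q a k N where "m = nat \<lceil>M\<rceil>" and "q = nat \<lceil>Q\<rceil>" and "a = nat \<lceil>4 * A\<rceil>"
    and "k = nat \<lfloor>10 * A\<rfloor> + 1" and "N = nat \<lceil>x powr (88/100)\<rceil>"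
  have x: "0 < x" using large by simp
  have n: "real n = x" by (simp add: x_def)
  have m: "M \<le> m" "m \<le> 2 * M" "m \<le> x" "0 < m" using large c4 unfolding m_def by linarith+
  have q: "Q \<le> q" "q \<le> 2 * Q" "q \<le> Q + 1" "1 < q" using large unfolding q_def by linarith+
  have a: "4 * A \<le> a" "a \<le> 4 * A + 1" "100 \<le> real a" using large unfolding a_def by linarith+
  have k: "10 * A \<le> k" "k \<le> 10 * A + 1" "0 < k" using large unfolding k_def by linarith+
  have N: "x powr (88/100) \<le> N" "N \<le> x powr (88/100) + 1" using powr_ge_zero[of x "88/100"] unfolding N_def by linarith+
  have N0: "0 < N" using N(1) x by (metis of_nat_0_less_iff less_le_trans powr_gt_zero less_irrefl)
  have AQ: "A * Q = x" using x large by (simp add: A_def Q_def flip: real_sqrt_mult)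
  have A2: "A * A = x * L" using x large by (simp add: A_def)
  have e44: "x powr (- (44/100)) = exp (- (44/100 * L))" using x by (simp add: powr_def L_def)
  have Mx: "x / M = x powr (1/20)"
  proof -
    have "x / M = x powr 1 / x powr (19/20)" using x by (simp add: M_def)
    also have "\<dots> = x powr (1 - 19/20)" by (rule powr_diff[symmetric])
    finally show ?thesis by simp
  qed
  have am: "a \<le> m"
  proof -
    have "x powr (- (44/100)) \<le> 1" unfolding e44 using large by simp
    then have "x powr (- (44/100)) * M \<le> 1 * M" using large by (intro mult_right_mono) auto
    then have "real a \<le> real m" using c2 a(2) large m(1) by linarith
    then show ?thesis by simp
  qed
  define s \<Delta> where "s = 3/2 * (real n / m)" and "\<Delta> = 3/2 * m / q"
  have s: "s \<le> 3/2 * x powr (1/20)" "1 \<le> s" "0 < s"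
  proof -
    have "x / m \<le> x / M" using m large x by (intro divide_left_mono) auto
    then show "s \<le> 3/2 * x powr (1/20)" by (simp add: s_def n Mx)
    have "m * 1 \<le> m * s" using c15 m by (simp add: s_def n)
    then show "1 \<le> s" using m by simp
    then show "0 < s" by simp
  qed
  have \<Delta>: "\<Delta> \<le> 3 * M / Q" "0 \<le> \<Delta>"
  proof -
    have "3/2 * m / q \<le> 3/2 * (2 * M) / Q" using m q large by (intro frac_le) auto
    then show "\<Delta> \<le> 3 * M / Q" by (simp add: \<Delta>_def)
  qed (simp add: \<Delta>_def)
  have s\<Delta>: "s * \<Delta> \<le> 9/16 * a"
  proof -
    have "s * \<Delta> = 9/4 * (x / q)" using m by (simp add: s_def \<Delta>_def n)
    also have "\<dots> \<le> 9/4 * (x / Q)" using q large x by (intro mult_left_mono divide_left_mono) auto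
    also have "x / Q = A" using AQ large by (simp add: field_simps)
    finally show ?thesis using a by linarith
  qed
  have ln\<kappa>: "ln (x powr (1/400)) = L / 400" using x by (simp add: L_def)
  have lnm: "ln m \<le> L" using m x by (simp add: L_def)
  have powr1: "1 \<le> x powr p" if "0 \<le> p" for p using large that by (simp add: ge_one_powr_ge_zero)
  have maps: "2 * (m * exp (- (real n / m / 25))) + (n choose k) * ((m choose a) * (real a / m) ^ k)\<^sup>2 < 1"
  proof -
    have "x powr (1/20) / 50 = x / (2 * M) / 25" by (simp flip: Mx)
    also have "\<dots> \<le> x / m / 25" using m x by (intro divide_right_mono divide_left_mono) auto
    finally have "2 * (m * exp (- (real n / m / 25))) \<le> 2 * ((2 * M) * exp (- (x powr (1/20) / 50)))"
      using m by (intro mult_left_mono mult_mono) (auto simp: n)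
    then have 1: "2 * (m * exp (- (real n / m / 25))) \<le> 1/4" using c1 by linarith
    have "exp 1 * x / k \<le> exp 1 * x / (4 * A)"
      using k large x by (intro divide_left_mono) auto
    then have "exp 1 * x / k \<le> x powr (1/2)" using c18 by linarith
    then have 2: "real (n choose k) \<le> exp (k * (L / 2))"
      unfolding L_def using k c3 x by (intro binomial_le_exp_ln) (auto simp: x_def)
    have 3: "(m choose a) * (real a / m) ^ k \<le> exp (k / 2 - 2596/10000 * L * k)"
    proof (rule small_image_bound)
      have "100 * real a \<le> 41 * real k" using a(2) k(1) large by linarith
      then show "100 * real a \<le> 41 * real k" "a \<le> k" by linarith+
      have "real a / m \<le> (41/10 * A) / M" using a(2) m large by (intro frac_le) auto
      also have "\<dots> \<le> x powr (- (44/100))" using c2 large by (simp add: field_simps)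
      finally show "real a / m \<le> exp (- (44/100 * L))" unfolding e44 .
    qed (use am a large in auto)
    have "(n choose k) * ((m choose a) * (real a / m) ^ k)\<^sup>2 \<le> exp (k * (L / 2)) * (exp (k / 2 - 2596/10000 * L * k))\<^sup>2"
      using 2 3 by (intro mult_mono power_mono) auto
    also have "\<dots> = exp (k * (1 - 192/10000 * L))"
      by (simp add: power2_eq_square algebra_simps flip: exp_add)
    also have "\<dots> \<le> exp (- 1)"
    proof -
      \<comment> \<open>\<open>192/10000\<close> is \<open>2 * 2596/10000 - 1/2\<close>, the margin
        of the two maps over the number of \<open>k\<close>-sets. The bound
        \<open>105 \<le> L\<close> makes the bracket at least 1.\<close>
      have "1 \<le> real k * (192/10000 * L - 1)"
        using mult_mono[of 1 "real k" 1 "192/10000 * L - 1"] k(3) large by simp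
      then show ?thesis by (simp add: algebra_simps)
    qed
    also have "\<dots> \<le> 1/2" using exp_ge_add_one_self[of "1::real"] by (simp add: exp_minus field_simps)
    finally show ?thesis using 1 by linarith
  qed
  have fail: "m * exp (- (real m / (25 * real q))) + real m ^ (59 + 3) * (exp 1 / real q) ^ (2 * (59 + 1))
       + exp (2 - real a) + exp (1 - real N) \<le> 1/8"
  proof -
    have "M / (50 * Q) \<le> real m / (25 * real q)" using m q large by (intro frac_le) auto
    then have "m * exp (- (real m / (25 * real q))) \<le> (2 * M) * exp (- (M / (50 * Q)))"
      using m by (intro mult_mono) auto
    then have 1: "m * exp (- (real m / (25 * real q))) \<le> 1/32" using c5 by linarith
    have "real m ^ 62 * (exp 1 / real q) ^ 120 \<le> (2 * M) ^ 62 * (exp 1 / Q) ^ 120"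
      using m q large by (intro mult_mono power_mono divide_left_mono) auto
    then have "real m ^ 62 * (exp 1 / real q) ^ 120 \<le> 1/32" using c6 by (rule order_trans)
    then have 2: "real m ^ (59 + 3) * (exp 1 / real q) ^ (2 * (59 + 1)) \<le> 1/32" by simp
    have "exp (2 - real a) \<le> exp (2 - 4 * A)" "exp (1 - real N) \<le> exp (1 - x powr (88/100))"
      using a N by auto
    then show ?thesis using 1 2 c7 c8 by linarith
  qed
  define b where "b = (4 * A + 1) / x powr (1/25)"
  have b0: "0 \<le> b" using large by (simp add: b_def)
  show ?thesis
    unfolding k_def[symmetric]
  \<comment> \<open>In powers of \<open>n\<close>, up to logarithms, \<open>s\<close> is 0.05,
    \<open>a\<close> and \<open>q\<close> are 0.5, \<open>\<Delta>\<close> is 0.45 and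
    \<open>b\<close> is 0.46. \<open>D = 59\<close> puts \<open>m ^ 62\<close> at 58.9 against 60
    for \<open>q ^ 120\<close>. Since \<open>ln \<kappa> = L / 400\<close>, the choice
    \<open>K = 2000\<close> gives \<open>5 * L\<close>, enough for \<open>4 * (ln m + 1)\<close>.
    \<open>\<kappa>' * b\<close> has exponent 0.498, below that of \<open>q\<close>. The exponent
    0.88 of \<open>N\<close> lies between 0.95 - 0.076, forced by \<open>\<kappa>'\<close>, and
    0.89, beyond which \<open>N * (s * x)^2\<close> would exceed order \<open>n\<close>.\<close>
  proof (rule exists_two_bite_graph[where n = n and m = m and q = q and a = a and k = k and D = 59 and N = N
        and x = "x powr (1/200)" and K = 2000 and b = b and W = "x powr (1/25)" and h = "x powr (2/5)"
        and \<kappa> = "x powr (1/400)" and \<kappa>' = "x powr (38/1000)" and U = "15/100 * (real a * a)" and E = "2/100 * (real a * a)",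
        folded s_def \<Delta>_def])
    show "1 < q" "0 < m" "a \<le> m" "0 < N" "1 \<le> s" "0 \<le> b" by fact+
    show "1 \<le> x powr (1/400)" "1 \<le> x powr (38/1000)" by (auto intro: powr1)
    show "0 < x powr (1/25)" "0 < x powr (2/5)" using x by auto
    show "2 * (m * exp (- (real n / m / 25))) + (n choose k) * ((m choose a) * (real a / m) ^ k)\<^sup>2 < 1" by (rule maps)
    show "8 * x powr (1/400) * a / q \<le> x powr (1/200) * ln (x powr (1/400))"
    proof -
      have "8 * x powr (1/400) * a / q \<le> 8 * x powr (1/400) * (4 * A + 1) / Q"
        using a q large by (intro frac_le mult_left_mono) auto
      then show ?thesis unfolding ln\<kappa> using c9 by linarith
    qed
    show "8 * ln m \<le> x powr (1/200) * ln (x powr (1/400))" unfolding ln\<kappa> using lnm c10 by linarith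
    show "4 * (ln m + 1) \<le> 2000 * ln (x powr (1/400))" unfolding ln\<kappa> using lnm large(2) by argo
    show "x powr (38/1000) * b \<le> q" using c11 q unfolding b_def by linarith
    show "b * ln m \<le> N" using mult_left_mono[OF lnm b0] c12 N unfolding b_def by linarith
    show "m * exp 4 \<le> N * (x powr (38/1000))\<^sup>2"
    proof -
      have "m * exp 4 \<le> (2 * M) * exp 4" using m by (intro mult_right_mono) auto
      also have "\<dots> \<le> N * (x powr (38/1000))\<^sup>2"
        using c13 mult_right_mono[OF N(1), of "(x powr (38/1000))\<^sup>2"] by simp
      finally show ?thesis .
    qed
    show "m * exp (- (real m / (25 * real q))) + real m ^ (59 + 3) * (exp 1 / real q) ^ (2 * (59 + 1))
       + exp (2 - real a) + exp (1 - real N) \<le> 1/8" by (rule fail)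
    show "x powr (1/200) * s \<le> x powr (2/5)"
      using mult_left_mono[OF s(1), of "x powr (1/200)"] c14 by simp
    show "a \<le> b * x powr (1/25)" using a x by (simp add: b_def)
    \<comment> \<open>The summands have exponents 0.55, 0.85, 0.95, 0.995 and 0.99 in
      \<open>n\<close>, all below 1, whereas \<open>a * a\<close> is of order
      \<open>n * ln n\<close>.\<close>
    show "s * a + s * \<Delta> * ((s * 2000 * a / x powr (2/5))\<^sup>2 * (s * real 59)) + x powr (2/5) * (s * 2000 * a)
        + 2 * (a * (\<Delta> * (x powr (1/25) * x powr (1/200)))) + (N + b) * (s * x powr (1/200))\<^sup>2 \<le> 2/100 * (real a * a)"
    proof -
      have "s * a + s * \<Delta> * ((s * 2000 * a / x powr (2/5))\<^sup>2 * (s * 59)) + x powr (2/5) * (s * 2000 * a)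
          + 2 * (a * (\<Delta> * (x powr (1/25) * x powr (1/200)))) + (N + b) * (s * x powr (1/200))\<^sup>2
        \<le> 3/2 * x powr (1/20) * (4 * A + 1)
         + 3/2 * x powr (1/20) * (3 * M / Q) *
             ((3/2 * x powr (1/20) * 2000 * (4 * A + 1) / x powr (2/5))\<^sup>2 * (3/2 * x powr (1/20) * 59))
         + x powr (2/5) * (3/2 * x powr (1/20) * 2000 * (4 * A + 1))
         + 2 * ((4 * A + 1) * (3 * M / Q * (x powr (1/25) * x powr (1/200))))
         + (x powr (88/100) + 1 + b) * (3/2 * x powr (1/20) * x powr (1/200))\<^sup>2"
        using s \<Delta> a N b0 large
        by (intro add_mono mult_mono power_mono divide_right_mono order_refl) auto
      also have "\<dots> \<le> 32/100 * (x * L)" using c19 unfolding b_def .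
      also have "\<dots> = 2/100 * ((4 * A) * (4 * A))" by (simp flip: A2)
      also have "\<dots> \<le> 2/100 * (real a * a)" using a large by (intro mult_left_mono mult_mono) auto
      finally show ?thesis by simp
    qed
    \<comment> \<open>In units of \<open>a * a\<close> the losses are 1/100 for the diagonal, 1/50
      for \<open>\<Delta> * a\<close>, 9/16 for \<open>s * \<Delta> * a\<close> and twice 2/100 for
      the errors. More than 36/100 remains, and 30/100 is asked for.\<close>
    show "2 * (15/100 * (real a * a)) \<le> real a * a - a - (\<Delta> * a + 2/100 * (real a * a)) - (s * \<Delta> * a + 2/100 * (real a * a))"
    proof -
      have "\<Delta> \<le> a / 50" using \<Delta> c16 a by linarith
      then have "\<Delta> * a \<le> a / 50 * a" by (rule mult_right_mono) simp
      moreover have "s * \<Delta> * a \<le> 9/16 * a * a" using s\<Delta> by (rule mult_right_mono) simp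
      moreover have "100 * real a \<le> real a * a" using a(3) by (rule mult_right_mono) simp
      ultimately show ?thesis by simp
    qed
    show "(n choose a) * exp (- (15/100 * (real a * a)) / q) \<le> 1/8"
    proof -
      have "exp 1 * x / a \<le> exp 1 * x / (4 * A)"
        using a large x by (intro divide_left_mono) auto
      then have "exp 1 * x / a \<le> x powr (1/2)" using c18 by linarith
      then have 1: "real (n choose a) \<le> exp (a * (L / 2))"
        unfolding L_def using a(2,3) c3 x large by (intro binomial_le_exp_ln) (auto simp: x_def)
      \<comment> \<open>As \<open>L * Q = A\<close>, the quotient \<open>4 * A / Q\<close> is
        \<open>4 * L\<close>; passing to \<open>39/10\<close> absorbs the rounding of
        \<open>q\<close>.\<close>
      have "39/10 * L * q \<le> 39/10 * L * (Q + 1)" using q large by (intro mult_left_mono) auto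
      then have "39/10 * L \<le> a / q" using c17 a(1) q(4) by (simp add: field_simps)
      then have "15/100 * a * (39/10 * L) \<le> 15/100 * a * (a / q)" by (rule mult_left_mono) simp
      then have 2: "exp (- (15/100 * (real a * a)) / q) \<le> exp (- (15/100 * a * (39/10 * L)))" by simp
      have "(n choose a) * exp (- (15/100 * (real a * a)) / q) \<le> exp (a * (L / 2)) * exp (- (15/100 * a * (39/10 * L)))"
        using 1 2 by (intro mult_mono) auto
      also have "\<dots> = exp (- (85/1000 * (a * L)))" by (simp add: algebra_simps flip: exp_add)
      also have "\<dots> \<le> exp (- 3)"
        using mult_mono[of 100 "real a" 105 L] a(3) large by simp
      also have "\<dots> \<le> 1/8"
      proof -
        have "2 ^ 3 \<le> exp (1 :: real) ^ 3" using exp_ge_add_one_self[of "1::real"] by (intro power_mono) auto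
        then have "8 \<le> exp (3 :: real)" using exp_of_nat_mult[of 3 "1::real"] by simp
        then show ?thesis by (simp add: exp_minus field_simps)
      qed
      finally show ?thesis .
    qed
  qed (use x in auto)
qed

lemma eventually_exists_two_bite_graph:
  "\<forall>\<^sub>F n in sequentially. \<exists>G :: nat pair_pre_digraph. pair_graph G \<and> card (pverts G) = n \<and> triangle_free G
    \<and> independence_number G < nat \<lfloor>10 * sqrt (real n * ln (real n))\<rfloor> + 1"
proof -
  note lift = eventually_compose_filterlim[OF _ filterlim_real_sequentially]
  have x: "\<forall>\<^sub>F x :: real in at_top. 40 \<le> x"
    by real_asymp
  have L: "\<forall>\<^sub>F x :: real in at_top. 105 \<le> ln x"
    by real_asymp
  have A: "\<forall>\<^sub>F x :: real in at_top. 25 \<le> sqrt (x * ln x)"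
    by real_asymp
  have Q: "\<forall>\<^sub>F x :: real in at_top. 2 \<le> sqrt (x / ln x)"
    by real_asymp
  have M: "\<forall>\<^sub>F x :: real in at_top. 1 \<le> x powr (19/20)"
    by real_asymp
  have c1: "\<forall>\<^sub>F x :: real in at_top. 2 * ((2 * (x powr (19/20))) * exp (- (x powr (1/20) / 50))) \<le> 1/4"
    by real_asymp
  have c2: "\<forall>\<^sub>F x :: real in at_top. 41/10 * sqrt (x * ln x) \<le> x powr (- (44/100)) * (x powr (19/20))"
    by real_asymp
  have c3: "\<forall>\<^sub>F x :: real in at_top. 10 * sqrt (x * ln x) + 1 \<le> x"
    by real_asymp
  have c4: "\<forall>\<^sub>F x :: real in at_top. (x powr (19/20)) + 1 \<le> x"
    by real_asymp
  have c5: "\<forall>\<^sub>F x :: real in at_top. (2 * (x powr (19/20))) * exp (- ((x powr (19/20)) / (50 * sqrt (x / ln x)))) \<le> 1/32"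
    by real_asymp
  have c6: "\<forall>\<^sub>F x :: real in at_top. (2 * (x powr (19/20))) ^ 62 * (exp 1 / sqrt (x / ln x)) ^ 120 \<le> 1/32"
    by real_asymp
  have c7: "\<forall>\<^sub>F x :: real in at_top. exp (2 - 4 * sqrt (x * ln x)) \<le> 1/32"
    by real_asymp
  have c8: "\<forall>\<^sub>F x :: real in at_top. exp (1 - x powr (88/100)) \<le> 1/32"
    by real_asymp
  have c9: "\<forall>\<^sub>F x :: real in at_top. 8 * x powr (1/400) * (4 * sqrt (x * ln x) + 1) / sqrt (x / ln x) \<le> x powr (1/200) * (ln x / 400)"
    by real_asymp
  have c10: "\<forall>\<^sub>F x :: real in at_top. 8 * ln x \<le> x powr (1/200) * (ln x / 400)"
    by real_asymp
  have c11: "\<forall>\<^sub>F x :: real in at_top. x powr (38/1000) * ((4 * sqrt (x * ln x) + 1) / x powr (1/25)) \<le> sqrt (x / ln x)"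
    by real_asymp
  have c12: "\<forall>\<^sub>F x :: real in at_top. ((4 * sqrt (x * ln x) + 1) / x powr (1/25)) * ln x \<le> x powr (88/100)"
    by real_asymp
  have c13: "\<forall>\<^sub>F x :: real in at_top. (2 * (x powr (19/20))) * exp 4 \<le> x powr (88/100) * (x powr (38/1000))\<^sup>2"
    by real_asymp
  have c14: "\<forall>\<^sub>F x :: real in at_top. x powr (1/200) * (3/2 * x powr (1/20)) \<le> x powr (2/5)"
    by real_asymp
  have c15: "\<forall>\<^sub>F x :: real in at_top. 2 * (x powr (19/20)) \<le> x"
    by real_asymp
  have c16: "\<forall>\<^sub>F x :: real in at_top. 3 * (x powr (19/20)) / sqrt (x / ln x) \<le> 1/50 * (4 * sqrt (x * ln x))"
    by real_asymp
  have c17: "\<forall>\<^sub>F x :: real in at_top. 39/10 * ln x * (sqrt (x / ln x) + 1) \<le> 4 * sqrt (x * ln x)"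
    by real_asymp
  have c18: "\<forall>\<^sub>F x :: real in at_top. exp 1 * x / (4 * sqrt (x * ln x)) \<le> x powr (1/2)"
    by real_asymp
  have c19: "\<forall>\<^sub>F x :: real in at_top. 3/2 * x powr (1/20) * (4 * sqrt (x * ln x) + 1)
     + 3/2 * x powr (1/20) * (3 * (x powr (19/20)) / sqrt (x / ln x)) *
         ((3/2 * x powr (1/20) * 2000 * (4 * sqrt (x * ln x) + 1) / x powr (2/5))\<^sup>2 * (3/2 * x powr (1/20) * 59))
     + x powr (2/5) * (3/2 * x powr (1/20) * 2000 * (4 * sqrt (x * ln x) + 1))
     + 2 * ((4 * sqrt (x * ln x) + 1) * (3 * (x powr (19/20)) / sqrt (x / ln x) * (x powr (1/25) * x powr (1/200))))
     + (x powr (88/100) + 1 + (4 * sqrt (x * ln x) + 1) / x powr (1/25)) * (3/2 * x powr (1/20) * x powr (1/200))\<^sup>2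
     \<le> 32/100 * (x * ln x)"
    by real_asymp
  show ?thesis
    using lift[OF x] lift[OF L] lift[OF A] lift[OF Q] lift[OF M] lift[OF c1] lift[OF c2] lift[OF c3] lift[OF c4] lift[OF c5] lift[OF c6] lift[OF c7] lift[OF c8] lift[OF c9] lift[OF c10] lift[OF c11] lift[OF c12] lift[OF c13] lift[OF c14] lift[OF c15] lift[OF c16] lift[OF c17] lift[OF c18] lift[OF c19]
    by eventually_elim (rule exists_two_bite_graph_of_numerics)
qed

section \<open>Small \<open>n\<close> and the asymptotic statement\<close>

lemma exists_edgeless_graph:
  "\<exists>G :: nat pair_pre_digraph. pair_graph G \<and> card (pverts G) = n \<and> triangle_free G \<and> independence_number G \<le> n"
proof -
  let ?G = "\<lparr> pverts = {..<n}, parcs = {} \<rparr> :: nat pair_pre_digraph"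
  have "pair_graph ?G"
    by unfold_locales (auto simp: symmetric_def arcs_ends_def sym_def)
  moreover have "triangle_free ?G" by (simp add: triangle_free_def)
  moreover have "independence_number ?G < n + 1"
  proof (rule independence_number_less)
    fix T assume T: "T \<subseteq> pverts ?G" "card T = n + 1"
    then have "card T \<le> card {..<n}" by (intro card_mono) auto
    then show "\<not> independent_set ?G T" using T(2) by simp
  qed simp
  ultimately show ?thesis by (intro exI[of _ ?G]) auto
qed

text \<open>The constant 10 is attained without error for large \<open>n\<close>, so
  \<open>\<epsilon>\<close> only has to absorb finitely many cases. The range starts at 2 because
  for \<open>n = 1\<close> the factor \<open>sqrt (n ln n)\<close> is 0, while the independence
  number is 1.\<close>

theorem theorem1p3:
  shows "\<exists>\<epsilon> :: nat \<Rightarrow> real. \<epsilon> \<longlonglongrightarrow> 0 \<and>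
    (\<forall>n\<ge>2. \<exists>G :: nat pair_pre_digraph.
       pair_graph G \<and> card (pverts G) = n \<and> triangle_free G \<and>
       real (independence_number G) \<le> (10 + \<epsilon> n) * sqrt (real n * ln (real n)))"
proof -
  obtain n0 where n0: "\<And>n. n0 \<le> n \<Longrightarrow> \<exists>G :: nat pair_pre_digraph. pair_graph G \<and> card (pverts G) = n
      \<and> triangle_free G \<and> independence_number G < nat \<lfloor>10 * sqrt (real n * ln (real n))\<rfloor> + 1"
    using eventually_exists_two_bite_graph unfolding eventually_sequentially by blast
  \<comment> \<open>Below \<open>n0\<close> the edgeless graph serves: its independence number is at
    most \<open>n\<close>, and \<open>sqrt (n ln n)\<close> is at least 1 for
    \<open>n \<ge> 2\<close>.\<close>
  define \<epsilon> :: "nat \<Rightarrow> real" where "\<epsilon> n = (if n < n0 then real n else 0)" for n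
  have "\<forall>\<^sub>F n in sequentially. \<epsilon> n = 0"
    unfolding eventually_sequentially \<epsilon>_def by (intro exI[of _ n0]) auto
  then have "\<epsilon> \<longlonglongrightarrow> 0" by (rule tendsto_eventually)
  moreover have "\<exists>G :: nat pair_pre_digraph.
       pair_graph G \<and> card (pverts G) = n \<and> triangle_free G \<and>
       real (independence_number G) \<le> (10 + \<epsilon> n) * sqrt (real n * ln (real n))" if n: "n \<ge> 2" for n
  proof (cases "n < n0")
    case True
    obtain G :: "nat pair_pre_digraph" where G: "pair_graph G" "card (pverts G) = n" "triangle_free G" "independence_number G \<le> n"
      using exists_edgeless_graph by blast
    have "1 / 2 \<le> ln (2 :: real)"
    proof -
      have "exp (1/2 :: real) \<le> 1 + 1/2 + (1/2)^2" by (rule exp_bound) auto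
      then show ?thesis by (subst ln_ge_iff) (auto simp: power2_eq_square)
    qed
    also have "\<dots> \<le> ln (real n)" using n by simp
    finally have "1 \<le> real n * ln (real n)" using n mult_mono[of 2 "real n" "1/2" "ln (real n)"] by simp
    then have "1 \<le> sqrt (real n * ln (real n))" by simp
    then have "(10 + real n) * 1 \<le> (10 + real n) * sqrt (real n * ln (real n))" by (rule mult_left_mono) simp
    moreover have "real (independence_number G) \<le> real n" using G(4) by simp
    moreover have \<epsilon>n: "\<epsilon> n = real n" using True by (simp add: \<epsilon>_def)
    ultimately have "real (independence_number G) \<le> (10 + \<epsilon> n) * sqrt (real n * ln (real n))"
      unfolding \<epsilon>n by argo
    then show ?thesis using G(1-3) by blast
  next
    case False
    then obtain G :: "nat pair_pre_digraph" where G: "pair_graph G" "card (pverts G) = n" "triangle_free G"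
      "independence_number G < nat \<lfloor>10 * sqrt (real n * ln (real n))\<rfloor> + 1"
      using n0[of n] by (auto simp: not_less)
    have "real (independence_number G) \<le> real (nat \<lfloor>10 * sqrt (real n * ln (real n))\<rfloor>)"
      using G(4) by (intro of_nat_mono) simp
    also have "\<dots> \<le> 10 * sqrt (real n * ln (real n))"
      using n by (intro of_nat_floor) simp
    finally have "real (independence_number G) \<le> (10 + \<epsilon> n) * sqrt (real n * ln (real n))"
      using False by (simp add: \<epsilon>_def)
    then show ?thesis using G(1-3) by blast
  qed
  ultimately show ?thesis by blast
qed

end
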